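(* Let $E_1(\mu,D_1)=(\lambda_P(D_1),P(\mu,D_1),0)$ with $P(\mu,D_1)=(\mu-\lambda_P(D_1))D\gamma_1/D_1$. If $\lambda_P(D_1)<\mu<\mu_{c_1}(D_1,D_2)$, then $E_1(\mu,D_1)$ is locally asymptotically stable; if $\mu>\mu_{c_1}(D_1,D_2)$, then $E_1(\mu,D_1)$ is unstable (its Jacobian has exactly one eigenvalue with positive real part). Moreover, when $\mu>\mu_{c_1}(D_1,D_2)$, every solution of $( * )$ with initial data $N(0)>0$, $P(0)>0$, $Z(0)=0$ converges to $E_1(\mu,D_1)$ as $t\to\infty$.
   Context: Standing setup. Let $D>0$, $D_1>0$, $D_2>0$, $\gamma_1>0$, $\gamma_2>0$ be constants and $\mu>0$ a parameter. Let $f_1,f_2:[0,\infty)\to[0,\infty)$ be continuously differentiable and bounded, with $f_i(0)=0$, $f_i'(x)>0$ for all $x\ge 0$, $\lim_{N\to\infty}f_1(N)>\max(D,D_1)/\gamma_1$ and $\lim_{P\to\infty}f_2(P)>\max(D,D_2)/\gamma_2$. The system $( * )$ is $$\frac{dN}{dt}=(\mu-N)D-Pf_1(N),\quad \frac{dP}{dt}=\gamma_1Pf_1(N)-D_1P-Zf_2(P),\quad \frac{dZ}{dt}=\gamma_2Zf_2(P)-D_2Z.$$ $\lambda_P(d)$ is the unique number with $f_1(\lambda_P(d))=d/\gamma_1$, $\lambda_Z(d)$ the unique number with $f_2(\lambda_Z(d))=d/\gamma_2$, and $\mu_{c_1}(D_1,D_2)=\lambda_P(D_1)+D_1\lambda_Z(D_2)/(D\gamma_1)$.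 *)

theory Defs
  imports "HOL-Analysis.Analysis"
begin

text \<open>State vectors are (N, P, Z) encoded as real^3 with components 1, 2, 3.\<close>

definition npz :: "real \<Rightarrow> real \<Rightarrow> real \<Rightarrow> real^3" where
  "npz a b c = vector [a, b, c]"

definition npz_field ::
  "real \<Rightarrow> real \<Rightarrow> real \<Rightarrow> real \<Rightarrow> real \<Rightarrow> real \<Rightarrow> (real \<Rightarrow> real) \<Rightarrow> (real \<Rightarrow> real)
   \<Rightarrow> real^3 \<Rightarrow> real^3" where
  "npz_field \<mu> D D1 D2 \<gamma>1 \<gamma>2 f1 f2 x =
     npz ((\<mu> - x$1) * D - x$2 * f1 (x$1))
         (\<gamma>1 * x$2 * f1 (x$1) - D1 * x$2 - x$3 * f2 (x$2))
         (\<gamma>2 * x$3 * f2 (x$2) - D2 * x$3)"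

definition orthant :: "(real^3) set" where
  "orthant = {x. \<forall>i. 0 \<le> x$i}"

definition ode_solution :: "(real^3 \<Rightarrow> real^3) \<Rightarrow> (real \<Rightarrow> real^3) \<Rightarrow> bool" where
  "ode_solution F x \<longleftrightarrow>
     (\<forall>t\<ge>0. (x has_vector_derivative F (x t)) (at t within {0..}))"

definition lyap_stable_in :: "(real^3) set \<Rightarrow> (real^3 \<Rightarrow> real^3) \<Rightarrow> real^3 \<Rightarrow> bool" where
  "lyap_stable_in S F e \<longleftrightarrow>
     (\<forall>\<epsilon>>0. \<exists>\<delta>>0. \<forall>x0\<in>S. dist x0 e < \<delta> \<longrightarrow>
        (\<exists>x. ode_solution F x \<and> x 0 = x0) \<and>
        (\<forall>x. ode_solution F x \<and> x 0 = x0 \<longrightarrow> (\<forall>t\<ge>0. dist (x t) e < \<epsilon>)))"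

definition loc_asymp_stable_in :: "(real^3) set \<Rightarrow> (real^3 \<Rightarrow> real^3) \<Rightarrow> real^3 \<Rightarrow> bool" where
  "loc_asymp_stable_in S F e \<longleftrightarrow>
     lyap_stable_in S F e \<and>
     (\<exists>\<delta>>0. \<forall>x. ode_solution F x \<and> x 0 \<in> S \<and> dist (x 0) e < \<delta> \<longrightarrow> (x \<longlongrightarrow> e) at_top)"

definition jacobian :: "(real^3 \<Rightarrow> real^3) \<Rightarrow> real^3 \<Rightarrow> real^3^3" where
  "jacobian F e = matrix (frechet_derivative F (at e))"

definition is_eigenvalue :: "real^3^3 \<Rightarrow> complex \<Rightarrow> bool" where
  "is_eigenvalue A z \<longleftrightarrow>
     (\<exists>v::complex^3. v \<noteq> 0 \<and> (\<chi> i j. complex_of_real (A$i$j)) *v v = z *s v)"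

text \<open>lambda_P(d) and lambda_Z(d): the unique nonnegative solutions of
  f1(x) = d/gamma1, resp. f2(x) = d/gamma2.\<close>
definition lam :: "(real \<Rightarrow> real) \<Rightarrow> real \<Rightarrow> real \<Rightarrow> real" where
  "lam f \<gamma> d = (THE x. 0 \<le> x \<and> f x = d / \<gamma>)"

definition mu_c1 :: "real \<Rightarrow> real \<Rightarrow> real \<Rightarrow> (real \<Rightarrow> real) \<Rightarrow> (real \<Rightarrow> real) \<Rightarrow> real \<Rightarrow> real \<Rightarrow> real" where
  "mu_c1 D \<gamma>1 \<gamma>2 f1 f2 D1 D2 = lam f1 \<gamma>1 D1 + D1 * lam f2 \<gamma>2 D2 / (D * \<gamma>1)"

end

theory Submission
  imports Defs
begin

text \<open>
  Everything rests on one planar Lyapunov function. On the face \<open>Z = 0\<close>, with \<open>u = N - Ns\<close> and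
  \<open>v = P - Ps\<close>, the function \<open>\<phi>(N) + (P - Ps - Ps * ln (P / Ps)) / \<gamma>1\<close> with
  \<open>\<phi>' = 1 - f1(Ns) / f1(N)\<close> decreases along the flow, and adding a small multiple of \<open>u * v\<close> gives
  a function \<open>W\<close> that is comparable to \<open>u\<^sup>2 + v\<^sup>2\<close> and decays exponentially on every compact box
  inside the open quadrant. Trajectories on the face stay in such a box: \<open>\<gamma>1 * N + P\<close> is bounded by
  a linear differential inequality, this bounds \<open>N\<close> away from \<open>0\<close>, and the first function bounds
  \<open>P\<close> away from \<open>0\<close>. This gives convergence on the face.

  Near \<open>E1\<close> the sign of \<open>\<mu> - \<mu>c1\<close> is the sign of the growth rate \<open>\<gamma>2 * f2(Ps) - D2\<close> of \<open>Z\<close>. If it is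
  negative, \<open>W + \<kappa> * Z\<close> with \<open>\<kappa>\<close> large decays exponentially in the orthant, because the coupling term
  \<open>Z * f2(P)\<close> is linear in \<open>Z\<close>; solutions exist because the field composed with the projection to a
  small ball is globally Lipschitz. If it is positive, \<open>Z\<close> grows exponentially as long as the
  trajectory stays near \<open>E1\<close>. The Jacobian at \<open>E1\<close> is block triangular with this growth rate as one
  eigenvalue and a planar block of positive determinant and negative trace.
\<close>

section \<open>Scalar and Lipschitz differential equations\<close>

lemma norm_weighted_integral_le:
  fixes h :: "real \<Rightarrow> 'a::euclidean_space"
  assumes "K > 0" "0 \<le> t" and cont: "continuous_on {0..t} h"
    and bound: "\<And>s. s \<in> {0..t} \<Longrightarrow> norm (h s) \<le> c * exp (K * s)"
  shows "norm (exp (- K * t) *\<^sub>R integral {0..t} h) \<le> c / K"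
proof -
  have c: "0 \<le> c"
    using order_trans[OF norm_ge_zero bound[of 0]] assms(2) by auto
  have int: "((\<lambda>s. c * exp (K * s)) has_integral c * exp (K * t) / K - c * exp (K * 0) / K) {0..t}"
    using assms(1,2) by (intro fundamental_theorem_of_calculus)
      (auto intro!: derivative_eq_intros simp: has_real_derivative_iff_has_vector_derivative[symmetric])
  have "norm (integral {0..t} h) \<le> integral {0..t} (\<lambda>s. c * exp (K * s))"
    using cont bound int
    by (intro Henstock_Kurzweil_Integration.integral_norm_bound_integral integrable_continuous_real)
      (auto intro!: continuous_intros)
  also have "\<dots> = c * exp (K * t) / K - c / K"
    using integral_unique[OF int] by simp
  also have "\<dots> \<le> c * exp (K * t) / K"
    using c assms(1) by simp
  finally have "norm (integral {0..t} h) \<le> c * exp (K * t) / K" .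
  then have "exp (- K * t) * norm (integral {0..t} h) \<le> exp (- K * t) * (c * exp (K * t) / K)"
    by (intro mult_left_mono) auto
  also have "\<dots> = c / K"
    by (simp add: exp_minus field_simps)
  finally show ?thesis by simp
qed

text \<open>Banach's fixed point theorem for the unknown \<open>u t = exp (- K * t) *\<^sub>R (x t - x0)\<close>: the
  weight makes the Picard operator a contraction on the whole half line at once.\<close>

lemma global_solution_of_lipschitz_field:
  fixes G :: "'a::euclidean_space \<Rightarrow> 'a"
  assumes lip: "L-lipschitz_on UNIV G"
  shows "\<exists>x. x 0 = x0 \<and> (\<forall>t\<ge>0. (x has_vector_derivative G (x t)) (at t within {0..}))"
proof -
  define K where "K = 2 * L + 1"
  have L: "0 \<le> L" using lip by (rule lipschitz_on_nonneg)
  have K: "K > 0" using L by (simp add: K_def)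
  have G: "norm (G x - G y) \<le> L * norm (x - y)" for x y
    using lipschitz_onD[OF lip, of x y] by (simp add: dist_norm)
  have Gcont: "continuous_on UNIV G"
    using lip by (rule lipschitz_on_continuous_on)
  define h where "h u s = G (x0 + exp (K * s) *\<^sub>R apply_bcontfun u s)"
    for u :: "real \<Rightarrow>\<^sub>C 'a" and s
  have hcont: "continuous_on A (h u)" for A u
    unfolding h_def by (intro continuous_on_compose2[OF Gcont] continuous_intros) auto
  define T where "T u t = exp (- K * max 0 t) *\<^sub>R integral {0..max 0 t} (h u)" for u t
  have Tb: "norm (T u t) \<le> (norm (G x0) + L * norm u) / K" for u t
    unfolding T_def
  proof (rule norm_weighted_integral_le[OF K _ hcont])
    fix s assume s: "s \<in> {0..max 0 t}"
    have "norm (h u s) \<le> norm (G x0) + norm (h u s - G x0)"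
      by (metis add.commute diff_add_cancel norm_triangle_ineq)
    also have "norm (h u s - G x0) \<le> L * norm (exp (K * s) *\<^sub>R apply_bcontfun u s)"
      unfolding h_def using G[of _ x0] by (metis add_diff_cancel_left')
    also have "\<dots> \<le> L * (exp (K * s) * norm u)"
      using L norm_bounded[of u s] by (intro mult_left_mono) auto
    also have "norm (G x0) \<le> norm (G x0) * exp (K * s)"
      using s K by (intro mult_right_le_imp_le[of "norm (G x0)" 1]) (auto simp: mult_le_cancel_left1)
    finally show "norm (h u s) \<le> (norm (G x0) + L * norm u) * exp (K * s)"
      by (simp add: algebra_simps)
  qed auto
  have Tcont: "continuous_on UNIV (T u)" for u
  proof -
    have *: "continuous_on {0..} (\<lambda>t. integral {0..t} (h u))"
      unfolding continuous_on_eq_continuous_within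
    proof
      fix t :: real assume t: "t \<in> {0..}"
      have "((\<lambda>v. integral {0..v} (h u)) has_vector_derivative h u t) (at t within {0..t+1})"
        using t by (intro integral_has_vector_derivative hcont) auto
      then have "continuous (at t within {0..t+1}) (\<lambda>t. integral {0..t} (h u))"
        by (rule has_vector_derivative_continuous)
      moreover have "at t within {0..t+1} = at t within {0..}"
        by (rule at_within_nhd[of _ "{..<t+1}"]) auto
      ultimately show "continuous (at t within {0..}) (\<lambda>t. integral {0..t} (h u))"
        by simp
    qed
    show ?thesis
      unfolding T_def
      by (intro continuous_intros continuous_on_compose2[OF *]) auto
  qed
  have Tbc: "T u \<in> bcontfun" for u
    using Tcont Tb by (rule bcontfun_normI)
  have dist: "dist (Bcontfun (T u)) (Bcontfun (T v)) \<le> (1/2) * dist u v" for u v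
  proof (rule dist_bound)
    fix t
    have "T u t - T v t = exp (- K * max 0 t) *\<^sub>R integral {0..max 0 t} (\<lambda>s. h u s - h v s)"
      unfolding T_def
      by (subst integral_diff) (auto intro!: integrable_continuous_real hcont simp: scaleR_diff_right)
    moreover have "norm \<dots> \<le> (L * dist u v) / K"
    proof (rule norm_weighted_integral_le[OF K])
      fix s
      have "norm (h u s - h v s) \<le> L * norm (exp (K * s) *\<^sub>R (apply_bcontfun u s - apply_bcontfun v s))"
        unfolding h_def using G by (metis add_diff_cancel_left scaleR_diff_right)
      also have "\<dots> \<le> L * (exp (K * s) * dist u v)"
        using L dist_bounded[of u s v] by (intro mult_left_mono) (auto simp: dist_norm)
      finally show "norm (h u s - h v s) \<le> L * dist u v * exp (K * s)"
        by (simp add: algebra_simps)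
    qed (auto intro!: continuous_intros hcont)
    moreover have "(L * dist u v) / K \<le> (1/2) * dist u v"
      using L K by (simp add: K_def field_simps)
    ultimately have "dist (T u t) (T v t) \<le> (1/2) * dist u v"
      by (simp only: dist_norm[of "T u t"])
    then show "dist (apply_bcontfun (Bcontfun (T u)) t) (apply_bcontfun (Bcontfun (T v)) t)
        \<le> (1/2) * dist u v"
      by (simp add: Bcontfun_inverse Tbc)
  qed
  have "\<exists>!u. Bcontfun (T u) = u"
    using dist by (intro banach_fix_type[of "1/2"]) auto
  then obtain u where u: "Bcontfun (T u) = u" by blast
  have u': "apply_bcontfun u t = T u t" for t
    using arg_cong[OF u, of apply_bcontfun] Tbc by (simp add: Bcontfun_inverse)
  define x where "x t = x0 + exp (K * t) *\<^sub>R apply_bcontfun u t" for t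
  have x: "x t = x0 + integral {0..t} (h u)" if "t \<ge> 0" for t
    using that unfolding x_def u' T_def
    by (simp add: exp_minus)
  have hx: "h u t = G (x t)" for t
    by (simp add: h_def x_def)
  have "(x has_vector_derivative G (x t)) (at t within {0..})" if t: "t \<ge> 0" for t
  proof -
    have "((\<lambda>v. integral {0..v} (h u)) has_vector_derivative h u t) (at t within {0..t+1})"
      using t by (intro integral_has_vector_derivative hcont) auto
    moreover have "at t within {0..t+1} = at t within {0..}"
      by (rule at_within_nhd[of _ "{..<t+1}"]) auto
    ultimately have "((\<lambda>v. x0 + integral {0..v} (h u)) has_vector_derivative G (x t)) (at t within {0..})"
      by (auto intro!: derivative_eq_intros simp: hx)
    then show ?thesis
      by (rule has_vector_derivative_transform[rotated 2]) (use t x in auto)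
  qed
  moreover have "x 0 = x0" by (simp add: x)
  ultimately show ?thesis by blast
qed

lemma antitone_of_deriv_nonpos_within:
  fixes y :: "real \<Rightarrow> real"
  assumes "a \<le> b"
    and "\<And>t. t \<in> {a..b} \<Longrightarrow> (y has_real_derivative y' t) (at t within {a..b})"
    and "\<And>t. t \<in> {a..b} \<Longrightarrow> y' t \<le> 0"
  shows "y b \<le> y a"
proof -
  have "\<exists>t\<in>{a..b}. y b - y a = y' t * (b - a)"
    using assms by (intro mvt_very_simple) (auto simp: has_field_derivative_def)
  then obtain t where "t \<in> {a..b}" "y b - y a = y' t * (b - a)" by blast
  then show ?thesis
    using assms(1,3) mult_nonpos_nonneg[of "y' t" "b - a"] by auto
qed

lemma exponential_decay:
  fixes y :: "real \<Rightarrow> real"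
  assumes "0 \<le> T"
    and d: "\<And>t. t \<in> {0..T} \<Longrightarrow> (y has_real_derivative y' t) (at t within {0..T})"
    and le: "\<And>t. t \<in> {0..T} \<Longrightarrow> y' t \<le> - \<beta> * y t"
  shows "y T \<le> y 0 * exp (- \<beta> * T)"
proof -
  have "y T * exp (\<beta> * T) \<le> y 0 * exp (\<beta> * 0)"
  proof (rule antitone_of_deriv_nonpos_within[where y = "\<lambda>t. y t * exp (\<beta> * t)"
        and y' = "\<lambda>t. (y' t + \<beta> * y t) * exp (\<beta> * t)"])
    fix t assume t: "t \<in> {0..T}"
    show "((\<lambda>t. y t * exp (\<beta> * t)) has_real_derivative (y' t + \<beta> * y t) * exp (\<beta> * t)) (at t within {0..T})"
      by (rule derivative_eq_intros d[OF t] refl)+ (simp add: algebra_simps)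
    show "(y' t + \<beta> * y t) * exp (\<beta> * t) \<le> 0"
      using le[OF t] by (intro mult_nonpos_nonneg) auto
  qed fact
  then show ?thesis by (simp add: exp_minus field_simps)
qed

lemma linear_ode_sign:
  fixes y :: "real \<Rightarrow> real"
  assumes "0 \<le> T" and h: "continuous_on {0..T} h"
    and d: "\<And>t. t \<in> {0..T} \<Longrightarrow> (y has_real_derivative h t * y t) (at t within {0..T})"
  shows "\<exists>c>0. y T = c * y 0"
proof -
  obtain H where H: "\<And>t. t \<in> {0..T} \<Longrightarrow> (H has_real_derivative h t) (at t within {0..T})"
    using antiderivative_continuous[OF h] by (metis has_real_derivative_iff_has_vector_derivative)
  have d': "((\<lambda>t. y t * exp (- H t)) has_real_derivative 0) (at t within {0..T})"
    if t: "t \<in> {0..T}" for t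
    by (rule derivative_eq_intros d[OF t] H[OF t] refl)+ (simp add: algebra_simps)
  have "y T * exp (- H T) = y 0 * exp (- H 0)"
  proof (rule antisym)
    show "y T * exp (- H T) \<le> y 0 * exp (- H 0)"
      using d' by (rule antitone_of_deriv_nonpos_within[OF assms(1)]) auto
    have "- (y T * exp (- H T)) \<le> - (y 0 * exp (- H 0))"
      using DERIV_minus[OF d'] by (rule antitone_of_deriv_nonpos_within[OF assms(1)]) auto
    then show "y 0 * exp (- H 0) \<le> y T * exp (- H T)" by simp
  qed
  then have "y T = exp (H T - H 0) * y 0"
    by (simp add: exp_minus exp_diff field_simps)
  then show ?thesis by (intro exI[of _ "exp (H T - H 0)"]) auto
qed

lemma stays_below:
  fixes g :: "real \<Rightarrow> real"
  assumes cont: "continuous_on {0..} g" and init: "g 0 < c"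
    and step: "\<And>t. 0 < t \<Longrightarrow> (\<And>s. s \<in> {0..t} \<Longrightarrow> g s \<le> c) \<Longrightarrow> g t < c"
    and "0 \<le> t"
  shows "g t < c"
proof (rule ccontr)
  assume *: "\<not> g t < c"
  let ?A = "{0..t} \<inter> g -` {c..}"
  have cont': "continuous_on {0..t} g"
    using cont by (rule continuous_on_subset) auto
  have "closed ?A"
    using cont' by (intro continuous_closed_preimage) auto
  then have A: "compact ?A" "?A \<noteq> {}"
    using * \<open>0 \<le> t\<close> by (auto simp: compact_eq_bounded_closed bounded_Int)
  then obtain s where s: "s \<in> ?A" "\<forall>r\<in>?A. s \<le> r"
    using compact_attains_inf[of ?A] by blast
  have "\<exists>r. 0 \<le> r \<and> r \<le> s \<and> g r = c"
    using s init by (intro IVT') (auto intro: continuous_on_subset[OF cont])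
  then obtain r where "0 \<le> r" "r \<le> s" "g r = c" by blast
  with s have "g s = c" by force
  have "0 < s" using s(1) init by (cases "s = 0") auto
  moreover have "g r \<le> c" if "r \<in> {0..s}" for r
    using s that \<open>g s = c\<close> by (cases "r = s") force+
  ultimately have "g s < c" by (rule step)
  with \<open>g s = c\<close> show False by simp
qed

section \<open>Increasing functions and their potentials\<close>

lemma increment_bounds:
  fixes f f' :: "real \<Rightarrow> real"
  assumes cont: "continuous_on {0..} f'"
    and der: "\<And>x. 0 \<le> x \<Longrightarrow> (f has_real_derivative f' x) (at x within {0..})"
    and pos: "\<And>x. 0 \<le> x \<Longrightarrow> f' x > 0" and "0 \<le> a"
  shows "\<exists>m>0. \<exists>M>0. \<forall>x\<in>{a..b}. \<forall>y\<in>{a..b}.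
    m * (x - y)\<^sup>2 \<le> (f x - f y) * (x - y) \<and> \<bar>f x - f y\<bar> \<le> M * \<bar>x - y\<bar>"
proof (cases "a \<le> b")
  case True
  have cont': "continuous_on {a..b} f'"
    using cont by (rule continuous_on_subset) (use \<open>0 \<le> a\<close> in auto)
  obtain u where u: "u \<in> {a..b}" "\<And>x. x \<in> {a..b} \<Longrightarrow> f' u \<le> f' x"
    using continuous_attains_inf[of "{a..b}" f'] cont' True by auto
  obtain v where v: "v \<in> {a..b}" "\<And>x. x \<in> {a..b} \<Longrightarrow> f' x \<le> f' v"
    using continuous_attains_sup[of "{a..b}" f'] cont' True by auto
  have mvt: "\<exists>z\<in>{a..b}. f x - f y = f' z * (x - y)" if "x \<in> {a..b}" "y \<in> {a..b}" "y \<le> x" for x y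
  proof -
    have "\<exists>z\<in>{y..x}. f x - f y = f' z * (x - y)"
      using that \<open>0 \<le> a\<close>
      by (intro mvt_very_simple) (auto simp flip: has_field_derivative_def intro!: DERIV_subset[OF der])
    then show ?thesis using that by auto
  qed
  have mvt': "\<exists>z\<in>{a..b}. f x - f y = f' z * (x - y)" if "x \<in> {a..b}" "y \<in> {a..b}" for x y
  proof (cases "y \<le> x")
    case False
    then obtain z where "z \<in> {a..b}" "f y - f x = f' z * (y - x)"
      using mvt[of y x] \<open>x \<in> _\<close> \<open>y \<in> _\<close> by auto
    then show ?thesis by (intro bexI[of _ z]) (auto simp: algebra_simps)
  qed (use mvt that in auto)
  have "0 < f' u" "0 < f' v" using pos u v \<open>0 \<le> a\<close> by auto
  moreover have "\<forall>x\<in>{a..b}. \<forall>y\<in>{a..b}. f' u * (x - y)\<^sup>2 \<le> (f x - f y) * (x - y) \<and>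
      \<bar>f x - f y\<bar> \<le> f' v * \<bar>x - y\<bar>"
  proof (intro ballI conjI)
    fix x y assume xy: "x \<in> {a..b}" "y \<in> {a..b}"
    then obtain z where z: "z \<in> {a..b}" "f x - f y = f' z * (x - y)"
      using mvt' by blast
    have "(f x - f y) * (x - y) = f' z * (x - y)\<^sup>2"
      by (simp add: z power2_eq_square)
    then show "f' u * (x - y)\<^sup>2 \<le> (f x - f y) * (x - y)"
      using u(2)[OF z(1)] by (simp add: mult_right_mono)
    have "0 < f' z" using pos z \<open>0 \<le> a\<close> by auto
    then show "\<bar>f x - f y\<bar> \<le> f' v * \<bar>x - y\<bar>"
      using v(2)[OF z(1)] by (simp add: z abs_mult mult_right_mono)
  qed
  ultimately show ?thesis by blast
next
  case False
  then have "{a..b} = {}" by simp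
  then show ?thesis using zero_less_one by blast
qed

lemma less_of_deriv_pos_within:
  fixes f f' :: "real \<Rightarrow> real"
  assumes der: "\<And>x. 0 \<le> x \<Longrightarrow> (f has_real_derivative f' x) (at x within {0..})"
    and pos: "\<And>x. 0 \<le> x \<Longrightarrow> f' x > 0" and xy: "0 \<le> x" "x < y"
  shows "f x < f y"
proof -
  have "\<exists>z\<in>{x..y}. f y - f x = f' z * (y - x)"
    using xy by (intro mvt_very_simple)
      (auto simp flip: has_field_derivative_def intro!: DERIV_subset[OF der])
  then obtain z where z: "z \<in> {x..y}" "f y - f x = f' z * (y - x)" by blast
  then have "0 < f' z * (y - x)" using pos xy by auto
  with z show ?thesis by simp
qed

lemma lam_solution:
  fixes f f' :: "real \<Rightarrow> real"
  assumes der: "\<And>x. 0 \<le> x \<Longrightarrow> (f has_real_derivative f' x) (at x within {0..})"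
    and pos: "\<And>x. 0 \<le> x \<Longrightarrow> f' x > 0" and "f 0 = 0"
    and lim: "(f \<longlongrightarrow> L) at_top" "L > d / \<gamma>" and "0 < d" "0 < \<gamma>"
  shows "0 < lam f \<gamma> d" "f (lam f \<gamma> d) = d / \<gamma>"
proof -
  have "\<forall>\<^sub>F x in at_top. f x > d / \<gamma>"
    by (rule order_tendstoD(1)[OF lim])
  then have "\<forall>\<^sub>F x in at_top. f x > d / \<gamma> \<and> 0 \<le> x"
    by (rule eventually_conj[OF _ eventually_ge_at_top])
  then obtain b where b: "f b > d / \<gamma>" "0 \<le> b"
    using eventually_happens'[OF trivial_limit_at_top_linorder] by blast
  have fcont: "continuous_on {0..} f"
    by (rule DERIV_continuous_on[where D = f']) (use der in simp)
  have "\<exists>x. 0 \<le> x \<and> x \<le> b \<and> f x = d / \<gamma>"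
  proof (rule IVT')
    show "f 0 \<le> d / \<gamma>" "d / \<gamma> \<le> f b" "0 \<le> b"
      using b \<open>f 0 = 0\<close> \<open>0 < d\<close> \<open>0 < \<gamma>\<close> by auto
    show "continuous_on {0..b} f"
      using fcont by (rule continuous_on_subset) auto
  qed
  then obtain x where x: "0 \<le> x" "f x = d / \<gamma>" by blast
  have "y = x" if y: "0 \<le> y" "f y = d / \<gamma>" for y
  proof (rule ccontr)
    assume "y \<noteq> x"
    then consider "x < y" | "y < x" by linarith
    then show False
    proof cases
      case 1
      then have "f x < f y" using less_of_deriv_pos_within[OF der pos x(1)] by simp
      then show False using x y by simp
    next
      case 2
      then have "f y < f x" using less_of_deriv_pos_within[OF der pos y(1)] by simp
      then show False using x y by simp
    qed
  qed
  then have "lam f \<gamma> d = x"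
    unfolding lam_def using x by (blast intro: the_equality)
  moreover have "x \<noteq> 0" using x \<open>f 0 = 0\<close> \<open>0 < d\<close> \<open>0 < \<gamma>\<close> by auto
  ultimately show "0 < lam f \<gamma> d" "f (lam f \<gamma> d) = d / \<gamma>"
    using x by auto
qed

lemma potential_ge_quadratic:
  fixes \<psi> g :: "real \<Rightarrow> real"
  assumes der: "\<And>x. x \<in> {a..b} \<Longrightarrow> (\<psi> has_real_derivative g x) (at x within {a..b})"
    and g: "\<And>x. x \<in> {a..b} \<Longrightarrow> k * (x - c)\<^sup>2 \<le> g x * (x - c)"
    and c: "c \<in> {a..b}" "\<psi> c = 0" "g c = 0" and x: "x \<in> {a..b}"
  shows "k / 2 * (x - c)\<^sup>2 \<le> \<psi> x"
proof -
  define w where "w t = \<psi> t - k / 2 * (t - c)\<^sup>2" for t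
  have d: "(w has_real_derivative g t - k * (t - c)) (at t within S)"
    if "t \<in> {a..b}" "S \<subseteq> {a..b}" for t S
  proof -
    have "((\<lambda>t. k / 2 * (t - c)\<^sup>2) has_real_derivative k * (t - c)) (at t within S)"
      by (auto intro!: derivative_eq_intros)
    from DERIV_diff[OF DERIV_subset[OF der[OF that(1)] that(2)] this] show ?thesis
      unfolding w_def .
  qed
  have s: "0 \<le> (g t - k * (t - c)) * (t - c)" if "t \<in> {a..b}" for t
    using g[OF that] by (simp add: power2_eq_square algebra_simps)
  have s1: "0 \<le> g t - k * (t - c)" if "t \<in> {a..b}" "c \<le> t" for t
    using s[OF that(1)] that(2) c(3) by (cases "t = c") (auto simp: zero_le_mult_iff)
  have s2: "g t - k * (t - c) \<le> 0" if "t \<in> {a..b}" "t \<le> c" for t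
    using s[OF that(1)] that(2) c(3) by (cases "t = c") (auto simp: zero_le_mult_iff)
  have "w c \<le> w x"
  proof (cases "c \<le> x")
    case True
    have "- w x \<le> - w c"
    proof (rule antitone_of_deriv_nonpos_within[OF True, where y = "\<lambda>t. - w t" and y' = "\<lambda>t. - (g t - k * (t - c))"])
      fix t assume t: "t \<in> {c..x}"
      show "((\<lambda>x. - w x) has_real_derivative - (g t - k * (t - c))) (at t within {c..x})"
        using t x c(1) by (intro DERIV_minus d) auto
      show "- (g t - k * (t - c)) \<le> 0"
        using s1[of t] t x c(1) by auto
    qed
    then show ?thesis by simp
  next
    case False
    show ?thesis
    proof (rule antitone_of_deriv_nonpos_within[where y = w and y' = "\<lambda>t. g t - k * (t - c)"])
      show "x \<le> c" using False by simp
      fix t assume t: "t \<in> {x..c}"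
      show "(w has_real_derivative g t - k * (t - c)) (at t within {x..c})"
        using t x c(1) by (intro d) auto
      show "g t - k * (t - c) \<le> 0"
        using s2[of t] t x c(1) by auto
    qed
  qed
  then show ?thesis by (simp add: w_def c)
qed

lemma potential_quadratic_bounds:
  fixes \<psi> g :: "real \<Rightarrow> real"
  assumes der: "\<And>x. x \<in> {a..b} \<Longrightarrow> (\<psi> has_real_derivative g x) (at x within {a..b})"
    and g: "\<And>x. x \<in> {a..b} \<Longrightarrow> k * (x - c)\<^sup>2 \<le> g x * (x - c)"
      "\<And>x. x \<in> {a..b} \<Longrightarrow> g x * (x - c) \<le> K * (x - c)\<^sup>2"
    and c: "c \<in> {a..b}" "\<psi> c = 0" "g c = 0" and x: "x \<in> {a..b}"
  shows "k / 2 * (x - c)\<^sup>2 \<le> \<psi> x" "\<psi> x \<le> K / 2 * (x - c)\<^sup>2"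
proof -
  show "k / 2 * (x - c)\<^sup>2 \<le> \<psi> x"
    by (rule potential_ge_quadratic[OF der g(1) c x])
  have "- K / 2 * (x - c)\<^sup>2 \<le> - \<psi> x"
    by (rule potential_ge_quadratic[OF DERIV_minus[OF der], where c = c]) (use g(2) c x in auto)
  then show "\<psi> x \<le> K / 2 * (x - c)\<^sup>2" by simp
qed

section \<open>The planar Lyapunov function\<close>

locale npz_system =
  fixes D D1 D2 \<gamma>1 \<gamma>2 \<mu> :: real and f1 f2 f1' f2' :: "real \<Rightarrow> real" and L1 L2 :: real
  assumes D: "D > 0" and D1: "D1 > 0" and D2: "D2 > 0"
    and \<gamma>1: "\<gamma>1 > 0" and \<gamma>2: "\<gamma>2 > 0"
    and f1'_cont: "continuous_on {0..} f1'" and f2'_cont: "continuous_on {0..} f2'"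
    and f1_der: "\<And>x. 0 \<le> x \<Longrightarrow> (f1 has_real_derivative f1' x) (at x within {0..})"
    and f2_der: "\<And>x. 0 \<le> x \<Longrightarrow> (f2 has_real_derivative f2' x) (at x within {0..})"
    and f1'_pos: "\<And>x. 0 \<le> x \<Longrightarrow> f1' x > 0" and f2'_pos: "\<And>x. 0 \<le> x \<Longrightarrow> f2' x > 0"
    and f1_0: "f1 0 = 0" and f2_0: "f2 0 = 0"
    and f1_lim: "(f1 \<longlongrightarrow> L1) at_top" "L1 > D1 / \<gamma>1"
    and f2_lim: "(f2 \<longlongrightarrow> L2) at_top" "L2 > D2 / \<gamma>2"
    and \<mu>: "lam f1 \<gamma>1 D1 < \<mu>"
begin

definition "Ns = lam f1 \<gamma>1 D1"
definition "Ps = (\<mu> - Ns) * D * \<gamma>1 / D1"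
definition "F = npz_field \<mu> D D1 D2 \<gamma>1 \<gamma>2 f1 f2"
definition "E1 = npz Ns Ps 0"

lemma f1_increment:
  assumes "0 \<le> a"
  shows "\<exists>m>0. \<exists>M>0. \<forall>x\<in>{a..b}. \<forall>y\<in>{a..b}.
    m * (x - y)\<^sup>2 \<le> (f1 x - f1 y) * (x - y) \<and> \<bar>f1 x - f1 y\<bar> \<le> M * \<bar>x - y\<bar>"
  by (rule increment_bounds[OF f1'_cont f1_der f1'_pos assms])

lemma f2_increment:
  assumes "0 \<le> a"
  shows "\<exists>m>0. \<exists>M>0. \<forall>x\<in>{a..b}. \<forall>y\<in>{a..b}.
    m * (x - y)\<^sup>2 \<le> (f2 x - f2 y) * (x - y) \<and> \<bar>f2 x - f2 y\<bar> \<le> M * \<bar>x - y\<bar>"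
  by (rule increment_bounds[OF f2'_cont f2_der f2'_pos assms])


lemma Ns: "0 < Ns" "f1 Ns = D1 / \<gamma>1"
  unfolding Ns_def using lam_solution[OF f1_der f1'_pos f1_0 f1_lim D1 \<gamma>1] by auto

lemma Ps: "0 < Ps"
  using \<mu> D D1 \<gamma>1 by (simp add: Ps_def Ns_def)

lemma equilibrium: "(\<mu> - Ns) * D = Ps * f1 Ns"
  using D1 \<gamma>1 by (simp add: Ps_def Ns)

lemma f1_cont: "continuous_on {0..} f1"
  by (rule DERIV_continuous_on[where D = f1']) (use f1_der in simp)

lemma f2_cont: "continuous_on {0..} f2"
  by (rule DERIV_continuous_on[where D = f2']) (use f2_der in simp)

lemma f1_strict_mono: "0 \<le> x \<Longrightarrow> x < y \<Longrightarrow> f1 x < f1 y"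
  by (rule less_of_deriv_pos_within[OF f1_der f1'_pos])

lemma f2_strict_mono: "0 \<le> x \<Longrightarrow> x < y \<Longrightarrow> f2 x < f2 y"
  by (rule less_of_deriv_pos_within[OF f2_der f2'_pos])

lemma f1_pos: "0 < x \<Longrightarrow> 0 < f1 x"
  using f1_strict_mono[of 0 x] f1_0 by simp

lemma f1_mono: "0 \<le> x \<Longrightarrow> x \<le> y \<Longrightarrow> f1 x \<le> f1 y"
  using f1_strict_mono[of x y] by (cases "x = y") auto

lemma f2_mono: "0 \<le> x \<Longrightarrow> x \<le> y \<Longrightarrow> f2 x \<le> f2 y"
  using f2_strict_mono[of x y] by (cases "x = y") auto

lemma N_potential:
  assumes n: "0 < n1" "n1 \<le> Ns" "Ns \<le> n2"
  shows "\<exists>\<phi> k K. 0 < k \<and> 0 < K \<and> (\<forall>n\<in>{n1..n2}.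
    (\<phi> has_real_derivative 1 - f1 Ns / f1 n) (at n within {n1..n2}) \<and>
    k * (n - Ns)\<^sup>2 \<le> \<phi> n \<and> \<phi> n \<le> K * (n - Ns)\<^sup>2)"
proof -
  let ?g = "\<lambda>n. 1 - f1 Ns / f1 n"
  have fpos: "0 < f1 n" if "n \<in> {n1..n2}" for n
    using that n by (intro f1_pos) auto
  have "continuous_on {n1..n2} ?g"
    using n fpos by (intro continuous_intros continuous_on_subset[OF f1_cont]) (auto simp: less_imp_neq[symmetric])
  then obtain \<phi>0 where \<phi>0: "\<And>n. n \<in> {n1..n2} \<Longrightarrow> (\<phi>0 has_real_derivative ?g n) (at n within {n1..n2})"
    using antiderivative_continuous by (metis has_real_derivative_iff_has_vector_derivative)
  define \<phi> where "\<phi> n = \<phi>0 n - \<phi>0 Ns" for n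
  have \<phi>: "(\<phi> has_real_derivative ?g n) (at n within {n1..n2})" if "n \<in> {n1..n2}" for n
    unfolding \<phi>_def using DERIV_diff[OF \<phi>0[OF that] DERIV_const[of "\<phi>0 Ns"]] by simp
  obtain m M where mM: "0 < m" "0 < M"
    "\<And>x y. x \<in> {n1..n2} \<Longrightarrow> y \<in> {n1..n2} \<Longrightarrow> m * (x - y)\<^sup>2 \<le> (f1 x - f1 y) * (x - y)"
    "\<And>x y. x \<in> {n1..n2} \<Longrightarrow> y \<in> {n1..n2} \<Longrightarrow> \<bar>f1 x - f1 y\<bar> \<le> M * \<bar>x - y\<bar>"
    using f1_increment[OF less_imp_le[OF n(1)], of n2] by blast
  have g: "?g n * (n - Ns) = (f1 n - f1 Ns) * (n - Ns) / f1 n" if "n \<in> {n1..n2}" for n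
    using fpos[OF that] by (simp add: field_simps)
  have Nsin: "Ns \<in> {n1..n2}" using n by auto
  have lo: "m / f1 n2 * (n - Ns)\<^sup>2 \<le> ?g n * (n - Ns)" if "n \<in> {n1..n2}" for n
  proof -
    have "m / f1 n2 * (n - Ns)\<^sup>2 = m * (n - Ns)\<^sup>2 / f1 n2" by simp
    also have "\<dots> \<le> (f1 n - f1 Ns) * (n - Ns) / f1 n"
      using mM(1) mM(3)[OF that Nsin] fpos[OF that] f1_mono[of n n2] that n
      by (intro frac_le order_trans[OF _ mM(3)[OF that Nsin]]) auto
    finally show ?thesis using g[OF that] by simp
  qed
  have hi: "?g n * (n - Ns) \<le> M / f1 n1 * (n - Ns)\<^sup>2" if "n \<in> {n1..n2}" for n
  proof -
    have "(f1 n - f1 Ns) * (n - Ns) \<le> \<bar>f1 n - f1 Ns\<bar> * \<bar>n - Ns\<bar>"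
      by (metis abs_ge_self abs_mult)
    also have "\<dots> \<le> M * \<bar>n - Ns\<bar> * \<bar>n - Ns\<bar>"
      using mM(4)[OF that Nsin] by (rule mult_right_mono) simp
    also have "\<dots> = M * (n - Ns)\<^sup>2" by (simp add: power2_eq_square)
    finally have "(f1 n - f1 Ns) * (n - Ns) / f1 n \<le> M * (n - Ns)\<^sup>2 / f1 n1"
      using mM(2) fpos[of n1] fpos[OF that] f1_mono[of n1 n] that n
      by (intro frac_le) auto
    then show ?thesis using g[OF that] by simp
  qed
  have c: "Ns \<in> {n1..n2}" "\<phi> Ns = 0" "?g Ns = 0"
    using Nsin fpos[OF Nsin] by (auto simp: \<phi>_def)
  have bounds: "m / f1 n2 / 2 * (n - Ns)\<^sup>2 \<le> \<phi> n" "\<phi> n \<le> M / f1 n1 / 2 * (n - Ns)\<^sup>2"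
    if "n \<in> {n1..n2}" for n
    by (rule potential_quadratic_bounds[OF \<phi> lo hi c that]; assumption)+
  have "0 < m / f1 n2 / 2" "0 < M / f1 n1 / 2"
    using mM(1,2) f1_pos[of n1] f1_pos[of n2] n by auto
  with \<phi> bounds show ?thesis by blast
qed

definition "P_pot p = p - Ps - Ps * ln (p / Ps)"

lemma P_pot_deriv:
  "0 < p \<Longrightarrow> (P_pot has_real_derivative 1 - Ps / p) (at p within S)"
  unfolding P_pot_def using Ps by (auto intro!: derivative_eq_intros)

lemma P_pot_bounds:
  assumes p: "0 < p1" "p1 \<le> Ps" "Ps \<le> p2" "x \<in> {p1..p2}"
  shows "1 / p2 / 2 * (x - Ps)\<^sup>2 \<le> P_pot x" "P_pot x \<le> 1 / p1 / 2 * (x - Ps)\<^sup>2"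
proof -
  have g: "(1 - Ps / t) * (t - Ps) = (t - Ps)\<^sup>2 / t" if "t \<in> {p1..p2}" for t
  proof -
    have "1 - Ps / t = (t - Ps) / t" using that p by (simp add: diff_divide_distrib)
    then show ?thesis by (simp add: power2_eq_square)
  qed
  have lo: "1 / p2 * (t - Ps)\<^sup>2 \<le> (1 - Ps / t) * (t - Ps)" if "t \<in> {p1..p2}" for t
    using that p frac_le[of "(t - Ps)\<^sup>2" "(t - Ps)\<^sup>2" t p2] by (simp add: g)
  have hi: "(1 - Ps / t) * (t - Ps) \<le> 1 / p1 * (t - Ps)\<^sup>2" if "t \<in> {p1..p2}" for t
    using that p frac_le[of "(t - Ps)\<^sup>2" "(t - Ps)\<^sup>2" p1 t] by (simp add: g)
  have der: "(P_pot has_real_derivative 1 - Ps / t) (at t within {p1..p2})" if "t \<in> {p1..p2}" for t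
    using that p by (intro P_pot_deriv) auto
  have c: "Ps \<in> {p1..p2}" "P_pot Ps = 0" "1 - Ps / Ps = 0"
    using p Ps by (auto simp: P_pot_def)
  show "1 / p2 / 2 * (x - Ps)\<^sup>2 \<le> P_pot x" "P_pot x \<le> 1 / p1 / 2 * (x - Ps)\<^sup>2"
    by (rule potential_quadratic_bounds[OF der lo hi c p(4)]; assumption)+
qed

end

lemma cross_term_le:
  fixes u v :: real
  assumes "0 < a"
  shows "K * \<bar>u\<bar> * \<bar>v\<bar> \<le> a / 2 * v\<^sup>2 + K\<^sup>2 / (2 * a) * u\<^sup>2"
proof -
  have "0 \<le> (a * \<bar>v\<bar> - K * \<bar>u\<bar>)\<^sup>2 / (2 * a)" using assms by simp
  also have "\<dots> = a / 2 * v\<^sup>2 + K\<^sup>2 / (2 * a) * u\<^sup>2 - K * \<bar>u\<bar> * \<bar>v\<bar>"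
    using assms by (simp add: power2_eq_square field_simps)
  finally show ?thesis by simp
qed

context npz_system
begin

text \<open>Without the cross term the derivative of \<open>W\<close> along the planar flow is only negative
  semidefinite, since it does not see the deviation of \<open>P\<close>. A small multiple of
  \<open>(N - Ns) * (P - Ps)\<close> repairs this and makes the decay exponential.\<close>

lemma planar_lyapunov:
  assumes n: "0 < n1" "n1 \<le> Ns" "Ns \<le> n2" and p: "0 < p1" "p1 \<le> Ps" "Ps \<le> p2"
  shows "\<exists>W WN WP k C \<alpha>. 0 < k \<and> 0 < C \<and> 0 < \<alpha> \<and>
    (\<forall>x\<in>{n1..n2}. \<forall>y\<in>{p1..p2}.
      k * ((x - Ns)\<^sup>2 + (y - Ps)\<^sup>2) \<le> W x y \<and> W x y \<le> C * ((x - Ns)\<^sup>2 + (y - Ps)\<^sup>2) \<and>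
      WN x y * ((\<mu> - x) * D - y * f1 x) + WP x y * (\<gamma>1 * y * f1 x - D1 * y)
        \<le> - \<alpha> * ((x - Ns)\<^sup>2 + (y - Ps)\<^sup>2) \<and>
      \<bar>WP x y\<bar> \<le> C) \<and>
    (\<forall>N P N' P' t S. t \<in> S \<longrightarrow> N ` S \<subseteq> {n1..n2} \<longrightarrow> P ` S \<subseteq> {p1..p2} \<longrightarrow>
      (N has_real_derivative N') (at t within S) \<longrightarrow> (P has_real_derivative P') (at t within S) \<longrightarrow>
      ((\<lambda>s. W (N s) (P s)) has_real_derivative WN (N t) (P t) * N' + WP (N t) (P t) * P') (at t within S))"
proof -
  obtain \<phi> k1 K1 where \<phi>: "0 < k1" "0 < K1"
    "\<And>n. n \<in> {n1..n2} \<Longrightarrow> (\<phi> has_real_derivative 1 - f1 Ns / f1 n) (at n within {n1..n2})"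
    "\<And>n. n \<in> {n1..n2} \<Longrightarrow> k1 * (n - Ns)\<^sup>2 \<le> \<phi> n"
    "\<And>n. n \<in> {n1..n2} \<Longrightarrow> \<phi> n \<le> K1 * (n - Ns)\<^sup>2"
    using N_potential[OF n] by blast
  define k2 where "k2 = 1 / p2 / 2 / \<gamma>1"
  define K2 where "K2 = 1 / p1 / 2 / \<gamma>1"
  have k2: "0 < k2" "0 < K2" using p \<gamma>1 Ps by (auto simp: k2_def K2_def)
  have \<psi>: "k2 * (y - Ps)\<^sup>2 \<le> P_pot y / \<gamma>1" "P_pot y / \<gamma>1 \<le> K2 * (y - Ps)\<^sup>2" if "y \<in> {p1..p2}" for y
    using divide_right_mono[OF P_pot_bounds(1)[OF p that], of \<gamma>1]
      divide_right_mono[OF P_pot_bounds(2)[OF p that], of \<gamma>1] \<gamma>1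
    by (simp_all add: k2_def K2_def)
  obtain m M where m: "0 < m" and M: "0 < M" and
    mM: "\<forall>x\<in>{n1..n2}. \<forall>y\<in>{n1..n2}.
      m * (x - y)\<^sup>2 \<le> (f1 x - f1 y) * (x - y) \<and> \<bar>f1 x - f1 y\<bar> \<le> M * \<bar>x - y\<bar>"
    using f1_increment[OF less_imp_le[OF n(1)], of n2] by blast
  define c where "c = D * m / f1 n2"
  define a where "a = f1 n1"
  define K3 where "K3 = D + Ps * M"
  define K4 where "K4 = p2 * \<gamma>1 * M + K3\<^sup>2 / (2 * a)"
  have a: "0 < a" using n by (simp add: a_def f1_pos)
  have c: "0 < c" using m D n f1_pos[of n2] by (simp add: c_def)
  have K3: "0 < K3" using D M Ps by (simp add: K3_def add_pos_pos)
  have K4: "0 < K4" using p Ps \<gamma>1 M a by (auto simp: K4_def intro!: add_pos_nonneg)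
  define \<epsilon> where "\<epsilon> = Min {c / (2 * K4), k1, k2}"
  have \<epsilon>: "0 < \<epsilon>" "\<epsilon> \<le> c / (2 * K4)" "\<epsilon> \<le> k1" "\<epsilon> \<le> k2"
    using c K4 \<phi>(1) k2 by (auto simp: \<epsilon>_def)
  define W where "W x y = \<phi> x + P_pot y / \<gamma>1 + \<epsilon> * ((x - Ns) * (y - Ps))" for x y
  define WN where "WN x y = 1 - f1 Ns / f1 x + \<epsilon> * (y - Ps)" for x y
  define WP where "WP x y = (1 - Ps / y) / \<gamma>1 + \<epsilon> * (x - Ns)" for x y
  define k where "k = min k1 k2 / 2"
  define \<alpha> where "\<alpha> = min (c / 2) (\<epsilon> * a / 2)"
  define C where "C = max (max K1 K2 + \<epsilon>) ((1 + Ps / p1) / \<gamma>1 + \<epsilon> * (n2 - n1))"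
  have uv: "\<bar>u * v\<bar> \<le> (u\<^sup>2 + v\<^sup>2) / 2" for u v :: real
    using sum_squares_bound[of "\<bar>u\<bar>" "\<bar>v\<bar>"] by (simp add: abs_mult)
  have kpos: "0 < k" "0 < \<alpha>" "0 < C"
    using \<phi>(1,2) k2 c a \<epsilon>(1) by (auto simp: k_def \<alpha>_def C_def less_max_iff_disj)
  have lo: "k * ((x - Ns)\<^sup>2 + (y - Ps)\<^sup>2) \<le> W x y" if x: "x \<in> {n1..n2}" and y: "y \<in> {p1..p2}" for x y
  proof -
    have "\<bar>\<epsilon> * ((x - Ns) * (y - Ps))\<bar> \<le> \<epsilon> * (((x - Ns)\<^sup>2 + (y - Ps)\<^sup>2) / 2)"
      using mult_left_mono[OF uv[of "x - Ns" "y - Ps"], of \<epsilon>] \<epsilon>(1) by (simp add: abs_mult)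
    also have "\<dots> \<le> k1 / 2 * (x - Ns)\<^sup>2 + k2 / 2 * (y - Ps)\<^sup>2"
      using mult_right_mono[OF \<epsilon>(3), of "(x - Ns)\<^sup>2"] mult_right_mono[OF \<epsilon>(4), of "(y - Ps)\<^sup>2"]
      by (simp add: algebra_simps)
    finally have "k1 / 2 * (x - Ns)\<^sup>2 + k2 / 2 * (y - Ps)\<^sup>2 \<le> W x y"
      using \<phi>(4)[OF x] \<psi>(1)[OF y] by (simp add: W_def)
    moreover have "k * ((x - Ns)\<^sup>2 + (y - Ps)\<^sup>2) \<le> k1 / 2 * (x - Ns)\<^sup>2 + k2 / 2 * (y - Ps)\<^sup>2"
      unfolding distrib_left by (intro add_mono mult_right_mono) (auto simp: k_def)
    ultimately show ?thesis by linarith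
  qed
  have hi: "W x y \<le> C * ((x - Ns)\<^sup>2 + (y - Ps)\<^sup>2)" if x: "x \<in> {n1..n2}" and y: "y \<in> {p1..p2}" for x y
  proof -
    have "\<bar>\<epsilon> * ((x - Ns) * (y - Ps))\<bar> \<le> \<epsilon> * (((x - Ns)\<^sup>2 + (y - Ps)\<^sup>2) / 2)"
      using mult_left_mono[OF uv[of "x - Ns" "y - Ps"], of \<epsilon>] \<epsilon>(1) by (simp add: abs_mult)
    then have "\<epsilon> * ((x - Ns) * (y - Ps)) \<le> \<epsilon> / 2 * (x - Ns)\<^sup>2 + \<epsilon> / 2 * (y - Ps)\<^sup>2"
      unfolding abs_le_iff by (simp add: distrib_left add_divide_distrib)
    then have "W x y \<le> (K1 + \<epsilon> / 2) * (x - Ns)\<^sup>2 + (K2 + \<epsilon> / 2) * (y - Ps)\<^sup>2"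
      unfolding W_def distrib_right using \<phi>(5)[OF x] \<psi>(2)[OF y] by linarith
    also have "\<dots> \<le> C * (x - Ns)\<^sup>2 + C * (y - Ps)\<^sup>2"
      using \<epsilon>(1) by (intro add_mono mult_right_mono) (auto simp: C_def)
    finally show ?thesis by (simp add: algebra_simps)
  qed
  have WP: "\<bar>WP x y\<bar> \<le> C" if x: "x \<in> {n1..n2}" and y: "y \<in> {p1..p2}" for x y
  proof -
    have "\<bar>1 - Ps / y\<bar> \<le> 1 + Ps / p1"
    proof -
      have "0 \<le> Ps / y" using y p Ps by auto
      moreover have "Ps / y \<le> Ps / p1" using y p Ps by (intro frac_le) auto
      ultimately show ?thesis by linarith
    qed
    then have "\<bar>(1 - Ps / y) / \<gamma>1\<bar> \<le> (1 + Ps / p1) / \<gamma>1"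
      using \<gamma>1 by (simp add: divide_right_mono)
    moreover have "\<bar>\<epsilon> * (x - Ns)\<bar> \<le> \<epsilon> * (n2 - n1)"
      using \<epsilon>(1) x n by (auto simp: abs_mult)
    ultimately have "\<bar>WP x y\<bar> \<le> (1 + Ps / p1) / \<gamma>1 + \<epsilon> * (n2 - n1)"
      unfolding WP_def using abs_triangle_ineq by (meson add_mono order_trans)
    then show ?thesis by (simp add: C_def)
  qed
  have dec: "WN x y * ((\<mu> - x) * D - y * f1 x) + WP x y * (\<gamma>1 * y * f1 x - D1 * y)
        \<le> - \<alpha> * ((x - Ns)\<^sup>2 + (y - Ps)\<^sup>2)" if x: "x \<in> {n1..n2}" and y: "y \<in> {p1..p2}" for x y
  proof -
    define u v e f where "u = x - Ns" and "v = y - Ps" and "e = f1 x - f1 Ns" and "f = f1 x"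
    have f: "a \<le> f" "f \<le> f1 n2" "0 < f"
      using f1_mono[of n1 x] f1_mono[of x n2] x n f1_pos[of x] by (auto simp: a_def f_def)
    have Nsin: "Ns \<in> {n1..n2}" using n by simp
    have e: "m * u\<^sup>2 \<le> e * u" "\<bar>e\<bar> \<le> M * \<bar>u\<bar>"
      using mM x Nsin by (auto simp: e_def u_def)
    have ypos: "0 < y" using y p by auto
    have A: "(\<mu> - x) * D - y * f1 x = - (u * D) - Ps * e - v * f"
      using equilibrium by (simp add: u_def v_def e_def f_def algebra_simps)
    have B: "\<gamma>1 * y * f1 x - D1 * y = \<gamma>1 * y * e"
      using Ns(2) \<gamma>1 by (simp add: e_def field_simps)
    have "1 - f1 Ns / f1 x = e / f"
      using f(3) by (simp add: e_def f_def diff_divide_distrib)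
    then have WN: "WN x y = e / f + \<epsilon> * v" by (simp add: WN_def v_def)
    have "1 - Ps / y = v / y" using ypos by (simp add: v_def diff_divide_distrib)
    then have WP': "WP x y = v / y / \<gamma>1 + \<epsilon> * u" by (simp add: WP_def u_def)
    have eq: "WN x y * ((\<mu> - x) * D - y * f1 x) + WP x y * (\<gamma>1 * y * f1 x - D1 * y)
        = - ((D * (e * u) + Ps * e\<^sup>2) / f) + \<epsilon> * (v * (- (u * D) - Ps * e) - v\<^sup>2 * f + y * \<gamma>1 * (e * u))"
      unfolding A B WN WP' using f(3) ypos \<gamma>1 by (simp add: field_simps power2_eq_square)
    have t1: "c * u\<^sup>2 \<le> (D * (e * u) + Ps * e\<^sup>2) / f"
    proof -
      have "c * u\<^sup>2 = D * (m * u\<^sup>2) / f1 n2" by (simp add: c_def)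
      also have "\<dots> \<le> (D * (e * u) + Ps * e\<^sup>2) / f"
        using e(1) D Ps f m by (intro frac_le) (auto intro!: add_increasing2 mult_left_mono add_nonneg_nonneg mult_nonneg_nonneg
            order_trans[OF _ e(1)])
      finally show ?thesis .
    qed
    have "v * (- (u * D) - Ps * e) \<le> \<bar>v\<bar> * \<bar>- (u * D) - Ps * e\<bar>"
      by (metis abs_ge_self abs_mult)
    also have "\<dots> \<le> \<bar>v\<bar> * (\<bar>u\<bar> * D + Ps * (M * \<bar>u\<bar>))"
    proof (rule mult_left_mono)
      have "\<bar>- (u * D) - Ps * e\<bar> \<le> \<bar>u * D\<bar> + \<bar>Ps * e\<bar>" by linarith
      also have "\<dots> \<le> \<bar>u\<bar> * D + Ps * (M * \<bar>u\<bar>)"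
        using D Ps e(2) by (simp add: abs_mult)
      finally show "\<bar>- (u * D) - Ps * e\<bar> \<le> \<bar>u\<bar> * D + Ps * (M * \<bar>u\<bar>)" .
    qed simp
    also have "\<dots> = K3 * \<bar>u\<bar> * \<bar>v\<bar>" by (simp add: K3_def algebra_simps)
    also have "\<dots> \<le> a / 2 * v\<^sup>2 + K3\<^sup>2 / (2 * a) * u\<^sup>2"
      by (rule cross_term_le[OF a])
    finally have t2: "v * (- (u * D) - Ps * e) \<le> a / 2 * v\<^sup>2 + K3\<^sup>2 / (2 * a) * u\<^sup>2" .
    have t3: "a * v\<^sup>2 \<le> v\<^sup>2 * f" using f(1) by (simp add: mult.commute mult_right_mono)
    have "e * u \<le> M * \<bar>u\<bar> * \<bar>u\<bar>"
      using mult_right_mono[OF e(2), of "\<bar>u\<bar>"] by (metis abs_ge_self abs_ge_zero abs_mult order_trans)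
    then have eu: "e * u \<le> M * u\<^sup>2" by (simp add: power2_eq_square)
    have "0 \<le> e * u" using e(1) m by (meson mult_nonneg_nonneg less_imp_le order_trans zero_le_power2)
    then have "y * \<gamma>1 * (e * u) \<le> (p2 * \<gamma>1) * (M * u\<^sup>2)"
      using mult_mono[OF mult_right_mono[of y p2 \<gamma>1] eu] y p Ps \<gamma>1 by auto
    then have "v * (- (u * D) - Ps * e) - v\<^sup>2 * f + y * \<gamma>1 * (e * u) \<le> K4 * u\<^sup>2 - a / 2 * v\<^sup>2"
      using t2 t3 by (simp add: K4_def algebra_simps)
    then have "\<epsilon> * (v * (- (u * D) - Ps * e) - v\<^sup>2 * f + y * \<gamma>1 * (e * u)) \<le> \<epsilon> * (K4 * u\<^sup>2 - a / 2 * v\<^sup>2)"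
      using \<epsilon>(1) by (intro mult_left_mono) auto
    moreover have "\<epsilon> * K4 \<le> c / 2" using \<epsilon>(2) K4 by (simp add: field_simps)
    then have "\<epsilon> * K4 * u\<^sup>2 \<le> c / 2 * u\<^sup>2" by (rule mult_right_mono) simp
    moreover have "\<alpha> * u\<^sup>2 \<le> c / 2 * u\<^sup>2" "\<alpha> * v\<^sup>2 \<le> \<epsilon> * a / 2 * v\<^sup>2"
      unfolding \<alpha>_def by (intro mult_right_mono min.cobounded1 min.cobounded2 zero_le_power2)+
    ultimately show ?thesis
      unfolding eq using t1 by (simp add: u_def[symmetric] v_def[symmetric] algebra_simps)
  qed
  have der: "((\<lambda>s. W (N s) (P s)) has_real_derivative WN (N t) (P t) * N' + WP (N t) (P t) * P') (at t within S)"
    if t: "t \<in> S" and S: "N ` S \<subseteq> {n1..n2}" "P ` S \<subseteq> {p1..p2}"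
      and N: "(N has_real_derivative N') (at t within S)"
      and P: "(P has_real_derivative P') (at t within S)" for N P N' P' t S
  proof -
    have Nt: "N t \<in> {n1..n2}" and Pt: "0 < P t" using S t p by auto
    have 1: "((\<lambda>s. \<phi> (N s)) has_real_derivative (1 - f1 Ns / f1 (N t)) * N') (at t within S)"
      using DERIV_image_chain[OF DERIV_subset[OF \<phi>(3)[OF Nt] S(1)] N] by (simp add: o_def)
    have 2: "((\<lambda>s. P_pot (P s)) has_real_derivative (1 - Ps / P t) * P') (at t within S)"
      using DERIV_image_chain[OF P_pot_deriv[OF Pt] P] by (simp add: o_def)
    have 3: "((\<lambda>s. (N s - Ns) * (P s - Ps)) has_real_derivative N' * (P t - Ps) + P' * (N t - Ns))
        (at t within S)"
      using DERIV_mult[OF DERIV_diff[OF N DERIV_const[of Ns]] DERIV_diff[OF P DERIV_const[of Ps]]] by simp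
    show ?thesis
      unfolding W_def WN_def WP_def
      using DERIV_add[OF DERIV_add[OF 1 DERIV_cdivide[OF 2, of \<gamma>1]] DERIV_cmult[OF 3, of \<epsilon>]]
      by (rule DERIV_cong) (simp add: algebra_simps diff_divide_distrib)
  qed
  have "0 < k \<and> 0 < C \<and> 0 < \<alpha> \<and>
    (\<forall>x\<in>{n1..n2}. \<forall>y\<in>{p1..p2}.
      k * ((x - Ns)\<^sup>2 + (y - Ps)\<^sup>2) \<le> W x y \<and> W x y \<le> C * ((x - Ns)\<^sup>2 + (y - Ps)\<^sup>2) \<and>
      WN x y * ((\<mu> - x) * D - y * f1 x) + WP x y * (\<gamma>1 * y * f1 x - D1 * y)
        \<le> - \<alpha> * ((x - Ns)\<^sup>2 + (y - Ps)\<^sup>2) \<and>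
      \<bar>WP x y\<bar> \<le> C)"
    using kpos lo hi dec WP by simp
  with der show ?thesis
    by (rule_tac exI[of _ W], rule_tac exI[of _ WN], rule_tac exI[of _ WP],
        rule_tac exI[of _ k], rule_tac exI[of _ C], rule_tac exI[of _ \<alpha>]) simp
qed

end

section \<open>Stability\<close>

definition bdd_lipschitz_on :: "'a::metric_space set \<Rightarrow> ('a \<Rightarrow> real) \<Rightarrow> bool" where
  "bdd_lipschitz_on S g \<longleftrightarrow> bounded (g ` S) \<and> (\<exists>L. L-lipschitz_on S g)"

lemma bdd_lipschitz_on_const: "bdd_lipschitz_on S (\<lambda>_. c)"
  unfolding bdd_lipschitz_on_def by (auto simp: image_constant_conv intro: lipschitz_on_constant)

lemma bdd_lipschitz_on_diff:
  "bdd_lipschitz_on S f \<Longrightarrow> bdd_lipschitz_on S g \<Longrightarrow> bdd_lipschitz_on S (\<lambda>x. f x - g x)"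
  unfolding bdd_lipschitz_on_def by (auto intro: bounded_minus_comp lipschitz_on_diff)

lemma bdd_lipschitz_on_mult:
  assumes "bdd_lipschitz_on S f" "bdd_lipschitz_on S g"
  shows "bdd_lipschitz_on S (\<lambda>x. f x * g x)"
proof -
  obtain A B where A: "\<And>x. x \<in> S \<Longrightarrow> \<bar>f x\<bar> \<le> A" and B: "\<And>x. x \<in> S \<Longrightarrow> \<bar>g x\<bar> \<le> B"
    using assms unfolding bdd_lipschitz_on_def bounded_iff by auto
  obtain K L where K: "K-lipschitz_on S f" and L: "L-lipschitz_on S g"
    using assms unfolding bdd_lipschitz_on_def by auto
  have "bounded ((\<lambda>x. f x * g x) ` S)"
    unfolding bounded_iff
  proof (intro exI[of _ "\<bar>A\<bar> * \<bar>B\<bar>"] ballI, clarify)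
    fix x assume "x \<in> S"
    then show "norm (f x * g x) \<le> \<bar>A\<bar> * \<bar>B\<bar>"
      using A[of x] B[of x] by (auto simp: abs_mult intro!: mult_mono)
  qed
  moreover have "(\<bar>A\<bar> * L + \<bar>B\<bar> * K)-lipschitz_on S (\<lambda>x. f x * g x)"
  proof (rule lipschitz_onI)
    show "0 \<le> \<bar>A\<bar> * L + \<bar>B\<bar> * K"
      using lipschitz_on_nonneg[OF K] lipschitz_on_nonneg[OF L] by simp
    fix x y assume xy: "x \<in> S" "y \<in> S"
    have "dist (f x * g x) (f y * g y) = \<bar>f x * (g x - g y) + g y * (f x - f y)\<bar>"
      by (simp add: dist_real_def algebra_simps)
    also have "\<dots> \<le> \<bar>f x\<bar> * \<bar>g x - g y\<bar> + \<bar>g y\<bar> * \<bar>f x - f y\<bar>"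
      by (metis abs_mult abs_triangle_ineq)
    also have "\<dots> \<le> \<bar>A\<bar> * (L * dist x y) + \<bar>B\<bar> * (K * dist x y)"
      using A[OF xy(1)] B[OF xy(2)] lipschitz_onD[OF K xy] lipschitz_onD[OF L xy]
      by (intro add_mono mult_mono) (auto simp: dist_real_def)
    finally show "dist (f x * g x) (f y * g y) \<le> (\<bar>A\<bar> * L + \<bar>B\<bar> * K) * dist x y"
      by (simp add: algebra_simps)
  qed
  ultimately show ?thesis unfolding bdd_lipschitz_on_def by blast
qed

lemma bdd_lipschitz_on_component:
  fixes S :: "(real^'n) set"
  assumes "bounded S"
  shows "bdd_lipschitz_on S (\<lambda>x. x $ i)"
proof -
  have "bounded ((\<lambda>x. x $ i) ` S)"
    using assms by (rule bounded_component_cart)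
  moreover have "1-lipschitz_on S (\<lambda>x. x $ i)"
    by (rule lipschitz_onI) (auto simp: dist_vec_nth_le)
  ultimately show ?thesis unfolding bdd_lipschitz_on_def by blast
qed

lemma bdd_lipschitz_on_compose_component:
  fixes S :: "(real^'n) set"
  assumes M: "\<forall>u\<in>{a..b}. \<forall>v\<in>{a..b}. \<bar>f u - f v\<bar> \<le> M * \<bar>u - v\<bar>" "0 < (M::real)"
    and S: "\<And>x. x \<in> S \<Longrightarrow> x $ i \<in> {a..b}" "S \<noteq> {}"
  shows "bdd_lipschitz_on S (\<lambda>x. f (x $ i))"
proof -
  have ab: "a \<in> {a..b}" using S by fastforce
  have "bounded ((\<lambda>x. f (x $ i)) ` S)"
    unfolding bounded_iff
  proof (intro exI[of _ "\<bar>f a\<bar> + M * (b - a)"] ballI, clarify)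
    fix x assume x: "x \<in> S"
    have "\<bar>f (x $ i) - f a\<bar> \<le> M * \<bar>x $ i - a\<bar>"
      using M(1) S(1)[OF x] ab by blast
    also have "\<dots> \<le> M * (b - a)"
      using M(2) S(1)[OF x] by (intro mult_left_mono) auto
    finally show "norm (f (x $ i)) \<le> \<bar>f a\<bar> + M * (b - a)" by simp
  qed
  moreover have "M-lipschitz_on S (\<lambda>x. f (x $ i))"
  proof (rule lipschitz_onI)
    fix x y assume xy: "x \<in> S" "y \<in> S"
    have "\<bar>f (x $ i) - f (y $ i)\<bar> \<le> M * \<bar>x $ i - y $ i\<bar>"
      using M(1) S(1)[OF xy(1)] S(1)[OF xy(2)] by blast
    also have "\<dots> \<le> M * dist x y"
      using dist_vec_nth_le[of x i y] M(2) by (simp add: dist_real_def)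
    finally show "dist (f (x $ i)) (f (y $ i)) \<le> M * dist x y"
      by (simp add: dist_real_def)
  qed (use M in simp)
  ultimately show ?thesis unfolding bdd_lipschitz_on_def by blast
qed

lemma lipschitz_on_of_components:
  fixes G :: "real^'n \<Rightarrow> real^'m"
  assumes "\<And>i. bdd_lipschitz_on S (\<lambda>x. G x $ i)"
  shows "\<exists>L. L-lipschitz_on S G"
proof -
  have "\<forall>i. \<exists>L. L-lipschitz_on S (\<lambda>x. G x $ i)"
    using assms unfolding bdd_lipschitz_on_def by blast
  then obtain L where L: "\<And>i. (L i)-lipschitz_on S (\<lambda>x. G x $ i)" by metis
  have "(\<Sum>i\<in>UNIV. L i)-lipschitz_on S G"
  proof (rule lipschitz_onI)
    show "0 \<le> (\<Sum>i\<in>UNIV. L i)"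
      using lipschitz_on_nonneg[OF L] by (simp add: sum_nonneg)
    fix x y assume xy: "x \<in> S" "y \<in> S"
    have "dist (G x) (G y) \<le> (\<Sum>i\<in>UNIV. \<bar>(G x - G y) $ i\<bar>)"
      unfolding dist_norm by (rule norm_le_l1_cart)
    also have "\<dots> \<le> (\<Sum>i\<in>UNIV. L i * dist x y)"
      using lipschitz_onD[OF L xy] by (intro sum_mono) (simp add: dist_real_def)
    finally show "dist (G x) (G y) \<le> (\<Sum>i\<in>UNIV. L i) * dist x y"
      by (simp add: sum_distrib_right)
  qed
  then show ?thesis by blast
qed

lemma component_derivative:
  fixes x :: "real \<Rightarrow> real^'n"
  assumes "(x has_vector_derivative v) (at t within S)"
  shows "((\<lambda>s. x s $ i) has_real_derivative v $ i) (at t within S)"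
  using bounded_linear.has_vector_derivative[OF bounded_linear_vec_nth assms]
  by (simp add: has_real_derivative_iff_has_vector_derivative)

context npz_system
begin

lemma E1_nth [simp]: "E1 $ 1 = Ns" "E1 $ 2 = Ps" "E1 $ 3 = 0"
  by (simp_all add: E1_def npz_def)

lemma F_nth:
  "F x $ 1 = (\<mu> - x$1) * D - x$2 * f1 (x$1)"
  "F x $ 2 = \<gamma>1 * x$2 * f1 (x$1) - D1 * x$2 - x$3 * f2 (x$2)"
  "F x $ 3 = \<gamma>2 * x$3 * f2 (x$2) - D2 * x$3"
  by (simp_all add: F_def npz_field_def npz_def)

lemma dist_E1: "(dist y E1)\<^sup>2 = (y$1 - Ns)\<^sup>2 + (y$2 - Ps)\<^sup>2 + (y$3)\<^sup>2"
  by (simp add: dist_vec_def L2_set_def sum_3 dist_real_def)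

lemma F_lipschitz:
  assumes r: "0 \<le> r" "r < Ns" "r < Ps"
  shows "\<exists>L. L-lipschitz_on (cball E1 r) F"
proof (rule lipschitz_on_of_components)
  fix i :: 3
  have in1: "x $ 1 \<in> {Ns - r..Ns + r}" and in2: "x $ 2 \<in> {Ps - r..Ps + r}" if "x \<in> cball E1 r" for x
    using that dist_vec_nth_le[of E1 1 x] dist_vec_nth_le[of E1 2 x] by (auto simp: dist_real_def)
  have ne: "cball E1 r \<noteq> {}" using r by simp
  have c: "bdd_lipschitz_on (cball E1 r) (\<lambda>x. x $ i)" for i
    by (rule bdd_lipschitz_on_component) simp
  have g1: "bdd_lipschitz_on (cball E1 r) (\<lambda>x. f1 (x $ 1))"
  proof -
    obtain M where "0 < M" "\<forall>u\<in>{Ns - r..Ns + r}. \<forall>v\<in>{Ns - r..Ns + r}. \<bar>f1 u - f1 v\<bar> \<le> M * \<bar>u - v\<bar>"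
      using f1_increment[of "Ns - r" "Ns + r"] r by auto
    then show ?thesis by (intro bdd_lipschitz_on_compose_component[OF _ _ in1 ne])
  qed
  have g2: "bdd_lipschitz_on (cball E1 r) (\<lambda>x. f2 (x $ 2))"
  proof -
    obtain M where "0 < M" "\<forall>u\<in>{Ps - r..Ps + r}. \<forall>v\<in>{Ps - r..Ps + r}. \<bar>f2 u - f2 v\<bar> \<le> M * \<bar>u - v\<bar>"
      using f2_increment[of "Ps - r" "Ps + r"] r by auto
    then show ?thesis by (intro bdd_lipschitz_on_compose_component[OF _ _ in2 ne])
  qed
  note intros = bdd_lipschitz_on_diff bdd_lipschitz_on_mult bdd_lipschitz_on_const c g1 g2
  consider "i = 1" | "i = 2" | "i = 3" using exhaust_3 by blast
  then show "bdd_lipschitz_on (cball E1 r) (\<lambda>x. F x $ i)"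
    by cases (simp only: F_nth, intro intros)+
qed

text \<open>The growth rate of \<open>Z\<close> at \<open>P = p2\<close> is negative, so a large multiple of \<open>Z\<close> absorbs the
  coupling term \<open>Z * f2 P\<close>; a linear rather than quadratic term suffices because \<open>Z \<ge> 0\<close>.\<close>

lemma local_lyapunov:
  assumes p2: "Ps < p2" "\<gamma>2 * f2 p2 < D2"
  shows "\<exists>U r k C \<beta>. 0 < r \<and> r < Ns \<and> r < Ps \<and> 0 < k \<and> 0 < C \<and> 0 < \<beta> \<and>
    (\<forall>y\<in>cball E1 r. 0 \<le> y $ 3 \<longrightarrow> k * (dist y E1)\<^sup>2 \<le> U y \<and> U y \<le> C * dist y E1) \<and>
    (\<forall>x. \<forall>T\<ge>0. (\<forall>t\<in>{0..T}. (x has_vector_derivative F (x t)) (at t within {0..T})) \<longrightarrow>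
      x ` {0..T} \<subseteq> cball E1 r \<longrightarrow> 0 \<le> x 0 $ 3 \<longrightarrow>
      0 \<le> x T $ 3 \<and> U (x T) \<le> U (x 0) * exp (- \<beta> * T))"
proof -
  let ?n1 = "Ns / 2" and ?n2 = "Ns + 1" and ?p1 = "Ps / 2"
  define r where "r = min (min 1 (Ns / 2)) (min (Ps / 2) (p2 - Ps))"
  have r: "0 < r" "r \<le> 1" "r \<le> Ns / 2" "r \<le> Ps / 2" "r \<le> p2 - Ps"
    using Ns(1) Ps p2(1) unfolding r_def by linarith+
  have "\<exists>W WN WP k C \<alpha>. 0 < k \<and> 0 < C \<and> 0 < \<alpha> \<and>
    (\<forall>x\<in>{?n1..?n2}. \<forall>y\<in>{?p1..p2}.
      k * ((x - Ns)\<^sup>2 + (y - Ps)\<^sup>2) \<le> W x y \<and> W x y \<le> C * ((x - Ns)\<^sup>2 + (y - Ps)\<^sup>2) \<and>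
      WN x y * ((\<mu> - x) * D - y * f1 x) + WP x y * (\<gamma>1 * y * f1 x - D1 * y)
        \<le> - \<alpha> * ((x - Ns)\<^sup>2 + (y - Ps)\<^sup>2) \<and>
      \<bar>WP x y\<bar> \<le> C) \<and>
    (\<forall>N P N' P' t S. t \<in> S \<longrightarrow> N ` S \<subseteq> {?n1..?n2} \<longrightarrow> P ` S \<subseteq> {?p1..p2} \<longrightarrow>
      (N has_real_derivative N') (at t within S) \<longrightarrow> (P has_real_derivative P') (at t within S) \<longrightarrow>
      ((\<lambda>s. W (N s) (P s)) has_real_derivative WN (N t) (P t) * N' + WP (N t) (P t) * P') (at t within S))"
    using Ns Ps p2 by (intro planar_lyapunov) auto
  then obtain W WN WP k C \<alpha> where kC: "0 < k" "0 < C" "0 < \<alpha>" and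
    W: "\<forall>x\<in>{?n1..?n2}. \<forall>y\<in>{?p1..p2}.
      k * ((x - Ns)\<^sup>2 + (y - Ps)\<^sup>2) \<le> W x y \<and> W x y \<le> C * ((x - Ns)\<^sup>2 + (y - Ps)\<^sup>2) \<and>
      WN x y * ((\<mu> - x) * D - y * f1 x) + WP x y * (\<gamma>1 * y * f1 x - D1 * y)
        \<le> - \<alpha> * ((x - Ns)\<^sup>2 + (y - Ps)\<^sup>2) \<and>
      \<bar>WP x y\<bar> \<le> C" and
    der: "\<forall>N P N' P' t S. t \<in> S \<longrightarrow> N ` S \<subseteq> {?n1..?n2} \<longrightarrow> P ` S \<subseteq> {?p1..p2} \<longrightarrow>
      (N has_real_derivative N') (at t within S) \<longrightarrow> (P has_real_derivative P') (at t within S) \<longrightarrow>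
      ((\<lambda>s. W (N s) (P s)) has_real_derivative WN (N t) (P t) * N' + WP (N t) (P t) * P') (at t within S)"
    by (elim exE conjE)
  have B: "0 \<le> f2 p2" using f2_mono[of 0 p2] f2_0 Ps p2 by simp
  define a where "a = D2 - \<gamma>2 * f2 p2"
  have a: "0 < a" using p2 by (simp add: a_def)
  define \<kappa> where "\<kappa> = (C * f2 p2 + 1) / a"
  have \<kappa>: "0 < \<kappa>" "\<kappa> * a = C * f2 p2 + 1"
    using kC B a by (auto simp: \<kappa>_def intro!: divide_pos_pos add_nonneg_pos)
  define U where "U y = W (y$1) (y$2) + \<kappa> * y$3" for y :: "real^3"
  have box: "y $ 1 \<in> {?n1..?n2}" "y $ 2 \<in> {?p1..p2}" "y $ 3 \<le> 1" if "y \<in> cball E1 r" for y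
    using that dist_vec_nth_le[of E1 1 y] dist_vec_nth_le[of E1 2 y] dist_vec_nth_le[of E1 3 y] r
    by (auto simp: dist_real_def)
  define \<beta> where "\<beta> = min (\<alpha> / C) (1 / \<kappa>)"
  have \<beta>: "0 < \<beta>" "\<beta> * C \<le> \<alpha>" "\<beta> * \<kappa> \<le> 1"
    using kC \<kappa>(1) by (auto simp: \<beta>_def min_def field_simps)
  have bounds: "min k \<kappa> * (dist y E1)\<^sup>2 \<le> U y \<and> U y \<le> (C + \<kappa>) * dist y E1"
    if y: "y \<in> cball E1 r" "0 \<le> y $ 3" for y
  proof
    let ?q = "(y$1 - Ns)\<^sup>2 + (y$2 - Ps)\<^sup>2"
    have W': "k * ?q \<le> W (y$1) (y$2)" "W (y$1) (y$2) \<le> C * ?q"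
      using W box[OF y(1)] by auto
    have "(y$3)\<^sup>2 \<le> y$3"
      using y(2) box(3)[OF y(1)] by (simp add: power2_eq_square mult_left_le)
    then have "min k \<kappa> * (y$3)\<^sup>2 \<le> \<kappa> * y$3"
      using kC \<kappa> by (intro mult_mono) auto
    moreover have "min k \<kappa> * ?q \<le> k * ?q" by (intro mult_right_mono) auto
    ultimately show "min k \<kappa> * (dist y E1)\<^sup>2 \<le> U y"
      using W' by (simp add: dist_E1 U_def distrib_left)
    have d1: "dist y E1 \<le> 1" using y r by (simp add: dist_commute)
    have "?q \<le> (dist y E1)\<^sup>2" by (simp add: dist_E1)
    also have "\<dots> \<le> dist y E1" using d1 by (simp add: power2_eq_square mult_left_le)
    finally have "C * ?q \<le> C * dist y E1" using kC by simp
    moreover have "\<kappa> * y$3 \<le> \<kappa> * dist y E1"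
      using dist_vec_nth_le[of y 3 E1] \<kappa> by (simp add: dist_real_def)
    ultimately show "U y \<le> (C + \<kappa>) * dist y E1"
      using W' by (simp add: U_def distrib_right)
  qed
  have decay: "0 \<le> x T $ 3 \<and> U (x T) \<le> U (x 0) * exp (- \<beta> * T)"
    if T: "0 \<le> T" and x: "\<forall>t\<in>{0..T}. (x has_vector_derivative F (x t)) (at t within {0..T})"
      and sub: "x ` {0..T} \<subseteq> cball E1 r" and x0: "0 \<le> x 0 $ 3" for x T
  proof -
    have xd: "((\<lambda>s. x s $ i) has_real_derivative F (x t) $ i) (at t within {0..T})"
      if "t \<in> {0..T}" for t i
      using x that by (intro component_derivative) auto
    have xb: "x t $ 1 \<in> {?n1..?n2}" "x t $ 2 \<in> {?p1..p2}" if "t \<in> {0..T}" for t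
      using box sub that by blast+
    have Pc: "continuous_on {0..T} (\<lambda>t. x t $ 2)"
      using xd by (rule DERIV_continuous_on)
    have h: "continuous_on {0..T} (\<lambda>t. \<gamma>2 * f2 (x t $ 2) - D2)"
      using xb(2) Ps by (intro continuous_intros continuous_on_compose2[OF f2_cont Pc]) fastforce
    have Z: "0 \<le> x t $ 3" if t: "t \<in> {0..T}" for t
    proof -
      have "\<exists>c>0. x t $ 3 = c * x 0 $ 3"
      proof (rule linear_ode_sign)
        show "0 \<le> t" using t by simp
        show "continuous_on {0..t} (\<lambda>t. \<gamma>2 * f2 (x t $ 2) - D2)"
          using h by (rule continuous_on_subset) (use t in auto)
        fix s assume "s \<in> {0..t}"
        then have s: "s \<in> {0..T}" using t by auto
        show "((\<lambda>s. x s $ 3) has_real_derivative (\<gamma>2 * f2 (x s $ 2) - D2) * x s $ 3) (at s within {0..t})"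
          using DERIV_subset[OF xd[OF s, of 3], of "{0..t}"] t by (simp add: F_nth algebra_simps)
      qed
      then show ?thesis using x0 by auto
    qed
    have Ud: "((\<lambda>t. U (x t)) has_real_derivative
        WN (x t $ 1) (x t $ 2) * F (x t) $ 1 + WP (x t $ 1) (x t $ 2) * F (x t) $ 2 + \<kappa> * F (x t) $ 3)
        (at t within {0..T})" if t: "t \<in> {0..T}" for t
    proof -
      have "((\<lambda>s. W (x s $ 1) (x s $ 2)) has_real_derivative
        WN (x t $ 1) (x t $ 2) * F (x t) $ 1 + WP (x t $ 1) (x t $ 2) * F (x t) $ 2) (at t within {0..T})"
        using der[rule_format, of t "{0..T}" "\<lambda>s. x s $ 1" "\<lambda>s. x s $ 2"] t xd[OF t] xb by blast
      then show ?thesis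
        unfolding U_def by (intro DERIV_add DERIV_cmult xd[OF t])
    qed
    have "U (x T) \<le> U (x 0) * exp (- \<beta> * T)"
    proof (rule exponential_decay[OF T Ud])
      fix t assume t: "t \<in> {0..T}"
      define N P z where "N = x t $ 1" and "P = x t $ 2" and "z = x t $ 3"
      let ?q = "(N - Ns)\<^sup>2 + (P - Ps)\<^sup>2"
      have NP: "N \<in> {?n1..?n2}" "P \<in> {?p1..p2}" "0 \<le> z"
        using xb[OF t] Z[OF t] by (auto simp: N_def P_def z_def)
      have W': "W N P \<le> C * ?q" "\<bar>WP N P\<bar> \<le> C"
        "WN N P * ((\<mu> - N) * D - P * f1 N) + WP N P * (\<gamma>1 * P * f1 N - D1 * P) \<le> - \<alpha> * ?q"
        using W NP(1,2) by blast+
      have f2P: "0 \<le> f2 P" "f2 P \<le> f2 p2"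
        using f2_mono[of 0 P] f2_mono[of P p2] NP f2_0 Ps by auto
      have "- WP N P * (z * f2 P) \<le> C * (z * f2 P)"
        using W'(2) NP(3) f2P by (intro mult_right_mono) auto
      also have "\<dots> \<le> C * (z * f2 p2)"
        using kC NP(3) f2P by (intro mult_left_mono) auto
      finally have 1: "- WP N P * (z * f2 P) \<le> C * f2 p2 * z" by (simp add: algebra_simps)
      have "z * (\<gamma>2 * f2 P - D2) \<le> z * (- a)"
        using NP(3) f2P \<gamma>2 by (intro mult_left_mono) (auto simp: a_def)
      then have "\<kappa> * (z * (\<gamma>2 * f2 P - D2)) \<le> \<kappa> * (z * (- a))"
        by (rule mult_left_mono) (use \<kappa>(1) in simp)
      also have "\<dots> = - (C * f2 p2 * z + z)"
        using arg_cong[OF \<kappa>(2), of "\<lambda>s. s * z"] by (simp add: algebra_simps)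
      finally have 2: "\<kappa> * (z * (\<gamma>2 * f2 P - D2)) \<le> - (C * f2 p2 * z + z)" .
      have "\<beta> * (W N P + \<kappa> * z) \<le> \<beta> * (C * ?q + \<kappa> * z)"
        using W'(1) \<beta>(1) by (intro mult_left_mono) auto
      also have "\<dots> = (\<beta> * C) * ?q + (\<beta> * \<kappa>) * z" by (simp add: algebra_simps)
      also have "\<dots> \<le> \<alpha> * ?q + 1 * z"
        using \<beta> NP(3) by (intro add_mono mult_right_mono) auto
      finally have 3: "\<beta> * (W N P + \<kappa> * z) \<le> \<alpha> * ?q + z" by simp
      have "WN N P * ((\<mu> - N) * D - P * f1 N) + WP N P * (\<gamma>1 * P * f1 N - D1 * P - z * f2 P)
          + \<kappa> * (\<gamma>2 * z * f2 P - D2 * z)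
        = (WN N P * ((\<mu> - N) * D - P * f1 N) + WP N P * (\<gamma>1 * P * f1 N - D1 * P))
          + - WP N P * (z * f2 P) + \<kappa> * (z * (\<gamma>2 * f2 P - D2))"
        by (simp add: algebra_simps)
      also have "\<dots> \<le> - \<alpha> * ?q + C * f2 p2 * z - (C * f2 p2 * z + z)"
        using 1 2 W'(3) by linarith
      also have "\<dots> \<le> - \<beta> * (W N P + \<kappa> * z)"
        using 3 by simp
      finally show "WN (x t $ 1) (x t $ 2) * F (x t) $ 1 + WP (x t $ 1) (x t $ 2) * F (x t) $ 2
          + \<kappa> * F (x t) $ 3 \<le> - \<beta> * U (x t)"
        by (simp add: F_nth U_def N_def P_def z_def)
    qed
    then show ?thesis using Z[of T] T by simp
  qed
  have "r < Ns" "r < Ps" using r Ns Ps by auto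
  moreover have "0 < min k \<kappa>" "0 < C + \<kappa>" using kC \<kappa> by auto
  moreover have "\<forall>x. \<forall>T\<ge>0. (\<forall>t\<in>{0..T}. (x has_vector_derivative F (x t)) (at t within {0..T})) \<longrightarrow>
      x ` {0..T} \<subseteq> cball E1 r \<longrightarrow> 0 \<le> x 0 $ 3 \<longrightarrow>
      0 \<le> x T $ 3 \<and> U (x T) \<le> U (x 0) * exp (- \<beta> * T)"
    by (intro allI impI) (rule decay)
  moreover have "\<forall>y\<in>cball E1 r. 0 \<le> y $ 3 \<longrightarrow>
      min k \<kappa> * (dist y E1)\<^sup>2 \<le> U y \<and> U y \<le> (C + \<kappa>) * dist y E1"
    by (intro ballI impI) (rule bounds)
  ultimately show ?thesis
    using r(1) \<beta>(1)
    by (rule_tac exI[of _ U], rule_tac exI[of _ r], rule_tac exI[of _ "min k \<kappa>"],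
        rule_tac exI[of _ "C + \<kappa>"], rule_tac exI[of _ \<beta>]) (intro conjI)
qed

end

lemma tendsto_of_exp_dist_bound:
  fixes x :: "real \<Rightarrow> 'a::metric_space"
  assumes "0 < \<beta>" and bound: "\<And>t. 0 \<le> t \<Longrightarrow> (dist (x t) e)\<^sup>2 \<le> A * exp (- \<beta> * t)"
  shows "(x \<longlongrightarrow> e) at_top"
proof -
  have "filterlim (\<lambda>t. - \<beta> * t) at_bot at_top"
    using assms(1) by (intro filterlim_tendsto_neg_mult_at_bot[OF tendsto_const _ filterlim_ident]) auto
  then have "((\<lambda>t. exp (- \<beta> * t)) \<longlongrightarrow> 0) at_top"
    by (rule filterlim_compose[OF exp_at_bot])
  then have lim: "((\<lambda>t. A * exp (- \<beta> * t)) \<longlongrightarrow> 0) at_top"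
    by (rule tendsto_mult_right_zero)
  have "((\<lambda>t. (dist (x t) e)\<^sup>2) \<longlongrightarrow> 0) at_top"
  proof (rule tendsto_sandwich[OF _ _ tendsto_const lim])
    show "\<forall>\<^sub>F t in at_top. (dist (x t) e)\<^sup>2 \<le> A * exp (- \<beta> * t)"
      by (rule eventually_at_top_linorderI[of 0]) (rule bound)
  qed simp
  then have "((\<lambda>t. sqrt ((dist (x t) e)\<^sup>2)) \<longlongrightarrow> sqrt 0) at_top"
    by (rule tendsto_real_sqrt)
  then show ?thesis by (subst tendsto_dist_iff) simp
qed

lemma ode_solution_component_derivative:
  assumes "ode_solution G x" "0 \<le> t" "S \<subseteq> {0..}"
  shows "((\<lambda>s. x s $ i) has_real_derivative G (x t) $ i) (at t within S)"
proof -
  have "(x has_vector_derivative G (x t)) (at t within {0..})"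
    using assms unfolding ode_solution_def by blast
  then have "(x has_vector_derivative G (x t)) (at t within S)"
    using assms(3) by (rule has_vector_derivative_within_subset)
  then show ?thesis by (rule component_derivative)
qed

context npz_system
begin

lemma E1_loc_asymp_stable:
  assumes p2: "Ps < p2" "\<gamma>2 * f2 p2 < D2"
  shows "loc_asymp_stable_in orthant F E1"
proof -
  obtain U r k C \<beta> where r: "0 < r" "r < Ns" "r < Ps" and kC: "0 < k" "0 < C" "0 < \<beta>" and
    U: "\<forall>y\<in>cball E1 r. 0 \<le> y $ 3 \<longrightarrow> k * (dist y E1)\<^sup>2 \<le> U y \<and> U y \<le> C * dist y E1" and
    decay: "\<forall>x. \<forall>T\<ge>0. (\<forall>t\<in>{0..T}. (x has_vector_derivative F (x t)) (at t within {0..T})) \<longrightarrow>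
      x ` {0..T} \<subseteq> cball E1 r \<longrightarrow> 0 \<le> x 0 $ 3 \<longrightarrow>
      0 \<le> x T $ 3 \<and> U (x T) \<le> U (x 0) * exp (- \<beta> * T)"
    using local_lyapunov[OF p2] by (elim exE conjE)
  have trap: "dist (x t) E1 < \<rho> \<and> 0 \<le> x t $ 3 \<and> U (x t) \<le> U (x 0) * exp (- \<beta> * t)"
    if \<rho>: "0 < \<rho>" "\<rho> \<le> r" and G: "\<And>y. y \<in> cball E1 \<rho> \<Longrightarrow> G y = F y"
      and x: "\<And>t. 0 \<le> t \<Longrightarrow> (x has_vector_derivative G (x t)) (at t within {0..})"
      and x0: "x 0 \<in> orthant" "dist (x 0) E1 < min \<rho> (k * \<rho>\<^sup>2 / C)" and t: "0 \<le> t"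
    for \<rho> G x t
  proof -
    have x03: "0 \<le> x 0 $ 3" using x0 by (simp add: orthant_def)
    have seg: "0 \<le> x t $ 3 \<and> U (x t) \<le> U (x 0) * exp (- \<beta> * t)"
      if t: "0 \<le> t" and d: "\<And>s. s \<in> {0..t} \<Longrightarrow> dist (x s) E1 \<le> \<rho>" for t
    proof -
      have in\<rho>: "x s \<in> cball E1 \<rho>" if "s \<in> {0..t}" for s
        using d[OF that] by (simp add: dist_commute)
      have "\<forall>s\<in>{0..t}. (x has_vector_derivative F (x s)) (at s within {0..t})"
      proof
        fix s assume s: "s \<in> {0..t}"
        have "(x has_vector_derivative G (x s)) (at s within {0..t})"
          by (rule has_vector_derivative_within_subset[OF x]) (use s in auto)
        then show "(x has_vector_derivative F (x s)) (at s within {0..t})"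
          using G[OF in\<rho>[OF s]] by simp
      qed
      moreover have "x ` {0..t} \<subseteq> cball E1 r"
        using in\<rho> \<rho> by fastforce
      ultimately show ?thesis using decay[rule_format, OF t, of x] x03 by blast
    qed
    have cont: "continuous_on {0..} (\<lambda>t. dist (x t) E1)"
      by (intro continuous_intros continuous_on_vector_derivative[where f' = "\<lambda>t. G (x t)"]) (use x in auto)
    have below: "dist (x t) E1 < \<rho>" if "0 \<le> t" for t
    proof (rule stays_below[OF cont _ _ that])
      show "dist (x 0) E1 < \<rho>" using x0 by simp
      fix t assume t: "0 < t" and d: "\<And>s. s \<in> {0..t} \<Longrightarrow> dist (x s) E1 \<le> \<rho>"
      have s: "0 \<le> x t $ 3" "U (x t) \<le> U (x 0) * exp (- \<beta> * t)"
        using seg[OF less_imp_le[OF t] d] by auto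
      have "x 0 \<in> cball E1 r" "x t \<in> cball E1 r"
        using x0 d[of t] t \<rho> by (auto simp: dist_commute)
      then have b: "0 \<le> U (x 0)" "U (x 0) \<le> C * dist (x 0) E1" "k * (dist (x t) E1)\<^sup>2 \<le> U (x t)"
        using U x03 s(1) kC order_trans[of 0 "k * (dist (x 0) E1)\<^sup>2" "U (x 0)"] by auto
      note s(2)
      also have "U (x 0) * exp (- \<beta> * t) \<le> U (x 0) * 1"
        using b(1) kC t by (intro mult_left_mono) auto
      also have "\<dots> \<le> C * dist (x 0) E1" using b by simp
      also have "\<dots> < C * (k * \<rho>\<^sup>2 / C)"
        using x0(2) kC by (intro mult_strict_left_mono) auto
      also have "\<dots> = k * \<rho>\<^sup>2" using kC by simp
      finally have "k * (dist (x t) E1)\<^sup>2 < k * \<rho>\<^sup>2" using b(3) by simp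
      then have "(dist (x t) E1)\<^sup>2 < \<rho>\<^sup>2" using kC by simp
      then show "dist (x t) E1 < \<rho>" by (rule power2_less_imp_less) (use \<rho> in simp)
    qed
    show ?thesis using below seg[OF t] t by (auto simp: less_imp_le)
  qed
  have "lyap_stable_in orthant F E1"
    unfolding lyap_stable_in_def
  proof (intro allI impI)
    fix \<epsilon> :: real assume "0 < \<epsilon>"
    define \<rho> where "\<rho> = min r \<epsilon>"
    have \<rho>: "0 < \<rho>" "\<rho> \<le> r" "\<rho> \<le> \<epsilon>" using r \<open>0 < \<epsilon>\<close> by (auto simp: \<rho>_def)
    show "\<exists>\<delta>>0. \<forall>x0\<in>orthant. dist x0 E1 < \<delta> \<longrightarrow>
        (\<exists>x. ode_solution F x \<and> x 0 = x0) \<and>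
        (\<forall>x. ode_solution F x \<and> x 0 = x0 \<longrightarrow> (\<forall>t\<ge>0. dist (x t) E1 < \<epsilon>))"
    proof (intro exI[of _ "min \<rho> (k * \<rho>\<^sup>2 / C)"] conjI ballI impI allI)
      show "0 < min \<rho> (k * \<rho>\<^sup>2 / C)" using \<rho> kC by simp
      fix x0 assume x0: "x0 \<in> orthant" "dist x0 E1 < min \<rho> (k * \<rho>\<^sup>2 / C)"
      obtain L where L: "L-lipschitz_on (cball E1 \<rho>) F"
        using F_lipschitz[of \<rho>] \<rho> r by auto
      let ?cp = "closest_point (cball E1 \<rho>)"
      have "1-lipschitz_on UNIV ?cp"
        using \<rho> by (intro lipschitz_onI) (auto intro!: closest_point_lipschitz)
      moreover have "L-lipschitz_on (?cp ` UNIV) F"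
        using \<rho> by (intro lipschitz_on_subset[OF L]) (auto intro!: closest_point_in_set simp del: mem_cball)
      ultimately have lip: "(L * 1)-lipschitz_on UNIV (F \<circ> ?cp)"
        unfolding o_def by (intro lipschitz_on_compose2)
      define G where "G = F \<circ> ?cp"
      from global_solution_of_lipschitz_field[OF lip, of x0]
      obtain x where x: "x 0 = x0" "\<And>t. 0 \<le> t \<Longrightarrow> (x has_vector_derivative G (x t)) (at t within {0..})"
        unfolding G_def by blast
      have G: "G y = F y" if "y \<in> cball E1 \<rho>" for y
        using that by (simp add: G_def closest_point_self)
      have "x t \<in> cball E1 \<rho>" if "0 \<le> t" for t
        using trap[OF \<rho>(1,2) G x(2) _ _ that] x0 x(1) by (simp add: dist_commute less_imp_le)
      then have "G (x t) = F (x t)" if "0 \<le> t" for t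
        using G that by blast
      then have "ode_solution F x"
        unfolding ode_solution_def using x(2) by simp
      then show "\<exists>x. ode_solution F x \<and> x 0 = x0" using x(1) by blast
    next
      fix x0 x t
      assume "x0 \<in> orthant" "dist x0 E1 < min \<rho> (k * \<rho>\<^sup>2 / C)" "ode_solution F x \<and> x 0 = x0" "0 \<le> (t::real)"
      then have "dist (x t) E1 < \<rho>"
        using trap[of \<rho> F x t] \<rho> by (auto simp: ode_solution_def)
      then show "dist (x t) E1 < \<epsilon>" using \<rho>(3) by simp
    qed
  qed
  moreover have "\<exists>\<delta>>0. \<forall>x. ode_solution F x \<and> x 0 \<in> orthant \<and> dist (x 0) E1 < \<delta> \<longrightarrow> (x \<longlongrightarrow> E1) at_top"
  proof (intro exI[of _ "min r (k * r\<^sup>2 / C)"] conjI allI impI)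
    show "0 < min r (k * r\<^sup>2 / C)" using r kC by simp
    fix x assume x: "ode_solution F x \<and> x 0 \<in> orthant \<and> dist (x 0) E1 < min r (k * r\<^sup>2 / C)"
    have T: "dist (x t) E1 < r \<and> 0 \<le> x t $ 3 \<and> U (x t) \<le> U (x 0) * exp (- \<beta> * t)" if "0 \<le> t" for t
      using trap[of r F x t] x r that by (auto simp: ode_solution_def)
    show "(x \<longlongrightarrow> E1) at_top"
    proof (rule tendsto_of_exp_dist_bound[OF kC(3)])
      fix t :: real assume t: "0 \<le> t"
      have "k * (dist (x t) E1)\<^sup>2 \<le> U (x t)"
        using U T[OF t] by (simp add: dist_commute less_imp_le)
      also have "\<dots> \<le> U (x 0) * exp (- \<beta> * t)" using T[OF t] by simp
      finally show "(dist (x t) E1)\<^sup>2 \<le> U (x 0) / k * exp (- \<beta> * t)"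
        using kC by (simp add: field_simps)
    qed
  qed
  ultimately show ?thesis unfolding loc_asymp_stable_in_def by blast
qed

lemma E1_not_lyap_stable:
  assumes p1: "0 \<le> p1" "p1 < Ps" "D2 < \<gamma>2 * f2 p1"
  shows "\<not> lyap_stable_in orthant F E1"
proof
  define \<epsilon> where "\<epsilon> = Ps - p1"
  have \<epsilon>: "0 < \<epsilon>" using p1 by (simp add: \<epsilon>_def)
  assume "lyap_stable_in orthant F E1"
  then obtain \<delta> where \<delta>: "0 < \<delta>" and stable: "\<forall>x0\<in>orthant. dist x0 E1 < \<delta> \<longrightarrow>
        (\<exists>x. ode_solution F x \<and> x 0 = x0) \<and>
        (\<forall>x. ode_solution F x \<and> x 0 = x0 \<longrightarrow> (\<forall>t\<ge>0. dist (x t) E1 < \<epsilon>))"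
    using \<epsilon> unfolding lyap_stable_in_def by blast
  define x0 where "x0 = npz Ns Ps (\<delta> / 2)"
  have x0: "x0 $ 1 = Ns" "x0 $ 2 = Ps" "x0 $ 3 = \<delta> / 2"
    by (simp_all add: x0_def npz_def)
  have "x0 \<in> orthant"
    using Ns Ps \<delta> x0 unfolding orthant_def by (simp add: forall_3)
  moreover have "(dist x0 E1)\<^sup>2 = (\<delta> / 2)\<^sup>2"
    unfolding dist_E1 by (simp add: x0)
  then have "dist x0 E1 = \<delta> / 2" using \<delta> by (simp add: power2_eq_iff_nonneg)
  then have "dist x0 E1 < \<delta>" using \<delta> by simp
  ultimately obtain x where x: "ode_solution F x" "x 0 = x0" and near: "\<And>t. 0 \<le> t \<Longrightarrow> dist (x t) E1 < \<epsilon>"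
    using stable by blast
  define c where "c = \<gamma>2 * f2 p1 - D2"
  have c: "0 < c" using p1 by (simp add: c_def)
  define T where "T = 2 * \<epsilon> / (\<delta> * c)"
  have T: "0 \<le> T" using \<epsilon> \<delta> c by (simp add: T_def)
  have xd: "((\<lambda>s. x s $ i) has_real_derivative F (x t) $ i) (at t within {0..t1})" if "t \<in> {0..t1}" for t t1 i
    by (rule ode_solution_component_derivative[OF x(1)]) (use that in auto)
  have P: "p1 < x t $ 2" if "0 \<le> t" for t
    using near[OF that] dist_vec_nth_le[of "x t" 2 E1] by (simp add: dist_real_def \<epsilon>_def)
  have Z: "0 < x t $ 3" if "0 \<le> t" for t
  proof -
    have "\<exists>c>0. x t $ 3 = c * x 0 $ 3"
    proof (rule linear_ode_sign[OF that])
      have "continuous_on {0..t} (\<lambda>t. x t $ 2)"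
        using xd by (rule DERIV_continuous_on)
      moreover have "(\<lambda>t. x t $ 2) ` {0..t} \<subseteq> {0..}"
      proof (rule image_subsetI)
        fix s assume "s \<in> {0..t}"
        then show "x s $ 2 \<in> {0..}" using P[of s] p1(1) by simp
      qed
      ultimately have "continuous_on {0..t} (\<lambda>t. f2 (x t $ 2))"
        by (rule continuous_on_compose2[OF f2_cont])
      then show "continuous_on {0..t} (\<lambda>t. \<gamma>2 * f2 (x t $ 2) - D2)"
        by (intro continuous_on_diff continuous_on_mult continuous_on_const)
      fix s assume "s \<in> {0..t}"
      then show "((\<lambda>s. x s $ 3) has_real_derivative (\<gamma>2 * f2 (x s $ 2) - D2) * x s $ 3) (at s within {0..t})"
        using xd[of s t 3] by (simp add: F_nth algebra_simps)
    qed
    then show ?thesis using x(2) x0 \<delta> by auto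
  qed
  have "- x T $ 3 \<le> - x 0 $ 3 * exp (- (- c) * T)"
  proof (rule exponential_decay[OF T, where y = "\<lambda>t. - x t $ 3" and y' = "\<lambda>t. - F (x t) $ 3"])
    fix t assume t: "t \<in> {0..T}"
    show "((\<lambda>t. - x t $ 3) has_real_derivative - F (x t) $ 3) (at t within {0..T})"
      using t by (rule DERIV_minus[OF xd])
    have "f2 p1 \<le> f2 (x t $ 2)" using f2_mono[of p1] P[of t] p1 t by simp
    then have "c \<le> \<gamma>2 * f2 (x t $ 2) - D2" using \<gamma>2 by (simp add: c_def)
    then have "c * x t $ 3 \<le> (\<gamma>2 * f2 (x t $ 2) - D2) * x t $ 3"
      using Z[of t] t by (intro mult_right_mono) auto
    then show "- F (x t) $ 3 \<le> - (- c) * - x t $ 3"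
      by (simp add: F_nth algebra_simps)
  qed
  then have "\<delta> / 2 * exp (c * T) \<le> x T $ 3" by (simp add: x(2) x0)
  moreover have "\<delta> / 2 * (1 + c * T) \<le> \<delta> / 2 * exp (c * T)"
    using \<delta> by (intro mult_left_mono exp_ge_add_one_self) auto
  moreover have "\<delta> / 2 * (1 + c * T) = \<delta> / 2 + \<epsilon>"
    using \<delta> c by (simp add: T_def field_simps)
  moreover have "x T $ 3 < \<epsilon>"
    using near[OF T] dist_vec_nth_le[of "x T" 3 E1] by (simp add: dist_real_def)
  ultimately show False using \<delta> by simp
qed


section \<open>Convergence on the face \<open>Z = 0\<close>\<close>

lemma planar_potential_decreases:
  assumes x: "0 < x" and y: "0 < y"
  shows "(1 - f1 Ns / f1 x) * ((\<mu> - x) * D - y * f1 x)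
    + (1 - Ps / y) / \<gamma>1 * (\<gamma>1 * y * f1 x - D1 * y) \<le> 0"
proof -
  define u e f where "u = x - Ns" and "e = f1 x - f1 Ns" and "f = f1 x"
  have f: "0 < f" using f1_pos[OF x] by (simp add: f_def)
  have A: "(\<mu> - x) * D - y * f = - (u * D) - Ps * e - (y - Ps) * f"
    using equilibrium by (simp add: u_def e_def f_def algebra_simps)
  have B: "\<gamma>1 * y * f - D1 * y = \<gamma>1 * y * e"
    using Ns(2) \<gamma>1 by (simp add: e_def f_def field_simps)
  have q1: "1 - f1 Ns / f = e / f"
    using f by (simp add: e_def f_def diff_divide_distrib)
  have q2: "1 - Ps / y = (y - Ps) / y" using y by (simp add: diff_divide_distrib)
  have "e / f * (- (u * D) - Ps * e - (y - Ps) * f) + (y - Ps) / y / \<gamma>1 * (\<gamma>1 * y * e)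
      = - ((D * (e * u) + Ps * e\<^sup>2) / f)"
    using f y \<gamma>1 by (simp add: field_simps power2_eq_square)
  moreover have "0 \<le> e * u"
    using f1_mono[of Ns x] f1_mono[of x Ns] x Ns
    by (cases "Ns \<le> x") (auto simp: e_def u_def zero_le_mult_iff)
  then have "0 \<le> (D * (e * u) + Ps * e\<^sup>2) / f" using D Ps f by simp
  ultimately show ?thesis
    unfolding f_def[symmetric] A B q1 q2 by (simp only: neg_le_0_iff_le)
qed

lemma P_pot_sublevel:
  assumes "0 < p" "P_pot p \<le> c"
  shows "Ps * exp (- ((c + Ps) / Ps)) \<le> p"
proof -
  have "- (c + Ps) \<le> Ps * ln (p / Ps)" using assms by (simp add: P_pot_def)
  then have "- ((c + Ps) / Ps) \<le> ln (p / Ps)" using Ps by (simp add: field_simps)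
  then have "exp (- ((c + Ps) / Ps)) \<le> p / Ps"
    using assms(1) Ps by (simp add: ln_ge_iff)
  then show ?thesis using Ps by (simp add: field_simps)
qed

text \<open>Since \<open>f2\<close> is unconstrained at negative arguments, \<open>Z = 0\<close> only follows while \<open>P \<ge> 0\<close>, whereas
  \<open>P > 0\<close> needs \<open>Z = 0\<close>; the two are obtained together by continuous induction in time.\<close>

lemma boundary_face_invariant:
  assumes x: "ode_solution F x" and x0: "0 < x 0 $ 1" "0 < x 0 $ 2" "x 0 $ 3 = 0" and t: "0 \<le> t"
  shows "0 < x t $ 1" "0 < x t $ 2" "x t $ 3 = 0"
proof -
  note xd = ode_solution_component_derivative[OF x]
  have cont: "continuous_on S (\<lambda>t. x t $ i)" if "S \<subseteq> {0..}" for S i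
    by (rule DERIV_continuous_on[where D = "\<lambda>t. F (x t) $ i"], rule xd) (use that in auto)
  have N: "0 < x t $ 1" if "0 \<le> t" for t
  proof -
    have "- x t $ 1 < 0"
    proof (rule stays_below[OF _ _ _ that])
      show "continuous_on {0..} (\<lambda>t. - x t $ 1)"
        by (intro continuous_on_minus cont) simp
      show "- x 0 $ 1 < 0" using x0 by simp
      fix t assume t: "0 < t" and nn: "\<And>s. s \<in> {0..t} \<Longrightarrow> - x s $ 1 \<le> 0"
      show "- x t $ 1 < 0"
      proof (rule ccontr)
        assume "\<not> - x t $ 1 < 0"
        then have 0: "x t $ 1 = 0" using nn[of t] t by simp
        have "0 < F (x t) $ 1"
          using \<mu> Ns D by (simp add: F_nth 0 f1_0 Ns_def)
        then obtain d where d: "0 < d" "\<And>h. 0 < h \<Longrightarrow> t - h \<in> {0..t} \<Longrightarrow> h < d \<Longrightarrow> x (t - h) $ 1 < x t $ 1"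
          using has_real_derivative_pos_inc_left[OF xd[of t "{0..t}" 1]] t by auto
        define h where "h = min t d / 2"
        have "0 < h" "t - h \<in> {0..t}" "h < d" using d t by (auto simp: h_def min_def)
        then show False using d(2)[of h] nn[of "t - h"] 0 by simp
      qed
    qed
    then show ?thesis by simp
  qed
  have Z: "x t $ 3 = 0" if t: "0 \<le> t" and P: "\<And>s. s \<in> {0..t} \<Longrightarrow> 0 \<le> x s $ 2" for t
  proof -
    have "\<exists>c>0. x t $ 3 = c * x 0 $ 3"
    proof (rule linear_ode_sign[OF t])
      have "continuous_on {0..t} (\<lambda>t. f2 (x t $ 2))"
        by (rule continuous_on_compose2[OF f2_cont cont]) (use P in auto)
      then show "continuous_on {0..t} (\<lambda>t. \<gamma>2 * f2 (x t $ 2) - D2)"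
        by (intro continuous_on_diff continuous_on_mult continuous_on_const)
      fix s assume "s \<in> {0..t}"
      then show "((\<lambda>s. x s $ 3) has_real_derivative (\<gamma>2 * f2 (x s $ 2) - D2) * x s $ 3) (at s within {0..t})"
        using xd[of s "{0..t}" 3] by (simp add: F_nth algebra_simps)
    qed
    then show ?thesis using x0 by simp
  qed
  have P: "0 < x t $ 2" if "0 \<le> t" for t
  proof -
    have "- x t $ 2 < 0"
    proof (rule stays_below[OF _ _ _ that])
      show "continuous_on {0..} (\<lambda>t. - x t $ 2)"
        by (intro continuous_on_minus cont) simp
      show "- x 0 $ 2 < 0" using x0 by simp
      fix t assume t: "0 < t" and nn: "\<And>s. s \<in> {0..t} \<Longrightarrow> - x s $ 2 \<le> 0"
      have Z0: "x s $ 3 = 0" if "s \<in> {0..t}" for s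
        by (rule Z) (use that nn in auto)
      have "\<exists>c>0. x t $ 2 = c * x 0 $ 2"
      proof (rule linear_ode_sign)
        show "0 \<le> t" using t by simp
        have "continuous_on {0..t} (\<lambda>t. f1 (x t $ 1))"
          by (rule continuous_on_compose2[OF f1_cont cont]) (use N in \<open>auto simp: less_imp_le\<close>)
        then show "continuous_on {0..t} (\<lambda>t. \<gamma>1 * f1 (x t $ 1) - D1)"
          by (intro continuous_on_diff continuous_on_mult continuous_on_const)
        fix s assume s: "s \<in> {0..t}"
        then show "((\<lambda>s. x s $ 2) has_real_derivative (\<gamma>1 * f1 (x s $ 1) - D1) * x s $ 2) (at s within {0..t})"
          using xd[of s "{0..t}" 2] Z0[OF s] by (simp add: F_nth algebra_simps)
      qed
      then show "- x t $ 2 < 0" using x0 by auto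
    qed
    then show ?thesis by simp
  qed
  show "0 < x t $ 1" "0 < x t $ 2" "x t $ 3 = 0"
    using N P Z[OF t] t by (auto simp: less_imp_le)
qed

lemma boundary_face_convergence:
  assumes x: "ode_solution F x" and x0: "0 < x 0 $ 1" "0 < x 0 $ 2" "x 0 $ 3 = 0"
  shows "(x \<longlongrightarrow> E1) at_top"
proof -
  define N P where "N t = x t $ 1" and "P t = x t $ 2" for t
  have Npos: "0 < N t" and Ppos: "0 < P t" and Z0: "x t $ 3 = 0" if "0 \<le> t" for t
    using boundary_face_invariant[OF x x0 that] by (simp_all add: N_def P_def)
  have Nd: "(N has_real_derivative (\<mu> - N t) * D - P t * f1 (N t)) (at t within {0..T})"
    if "t \<in> {0..T}" for t T
    using ode_solution_component_derivative[OF x, of t "{0..T}" 1] that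
    by (simp add: F_nth N_def[abs_def] P_def)
  have Pd: "(P has_real_derivative \<gamma>1 * P t * f1 (N t) - D1 * P t) (at t within {0..T})"
    if "t \<in> {0..T}" for t T
    using ode_solution_component_derivative[OF x, of t "{0..T}" 2] Z0[of t] that
    by (simp add: F_nth N_def P_def[abs_def])
  define d where "d = min D D1"
  have d: "0 < d" "d \<le> D" "d \<le> D1" using D D1 by (auto simp: d_def)
  define M where "M = \<gamma>1 * \<mu> * D / d + max 0 (\<gamma>1 * N 0 + P 0 - \<gamma>1 * \<mu> * D / d)"
  have M: "\<gamma>1 * N T + P T \<le> M" if T: "0 \<le> T" for T
  proof -
    let ?y = "\<lambda>t. \<gamma>1 * N t + P t - \<gamma>1 * \<mu> * D / d"
    have "?y T \<le> ?y 0 * exp (- d * T)"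
    proof (rule exponential_decay[OF T])
      fix t assume t: "t \<in> {0..T}"
      show "(?y has_real_derivative \<gamma>1 * ((\<mu> - N t) * D - P t * f1 (N t))
          + (\<gamma>1 * P t * f1 (N t) - D1 * P t) - 0) (at t within {0..T})"
        by (intro DERIV_diff DERIV_add DERIV_cmult DERIV_const Nd[OF t] Pd[OF t])
      have "d * (\<gamma>1 * N t) \<le> D * (\<gamma>1 * N t)" "d * P t \<le> D1 * P t"
        using d Npos[of t] Ppos[of t] t \<gamma>1 by (auto intro!: mult_right_mono)
      moreover have "d * (\<gamma>1 * \<mu> * D / d) = \<gamma>1 * \<mu> * D" using d by simp
      ultimately show "\<gamma>1 * ((\<mu> - N t) * D - P t * f1 (N t))
          + (\<gamma>1 * P t * f1 (N t) - D1 * P t) - 0 \<le> - d * ?y t"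
        by (simp add: algebra_simps)
    qed
    also have "\<dots> \<le> max 0 (?y 0) * exp (- d * T)" by (intro mult_right_mono) auto
    also have "\<dots> \<le> max 0 (?y 0) * 1" using d T by (intro mult_left_mono) auto
    finally show ?thesis by (simp add: M_def)
  qed
  define n2 p2 where "n2 = max Ns (M / \<gamma>1)" and "p2 = max Ps M"
  have Nle: "N t \<le> n2" and Ple: "P t \<le> p2" if "0 \<le> t" for t
  proof -
    have "\<gamma>1 * N t \<le> M" using M[OF that] Ppos[OF that] by simp
    then have "N t \<le> M / \<gamma>1" using \<gamma>1 by (simp add: field_simps)
    then show "N t \<le> n2" by (simp add: n2_def)
    have "0 < \<gamma>1 * N t" using \<gamma>1 Npos[OF that] by simp
    then show "P t \<le> p2" using M[OF that] by (simp add: p2_def)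
  qed
  obtain L where L: "0 < L" "\<forall>x\<in>{0..n2}. \<bar>f1 x - f1 0\<bar> \<le> L * \<bar>x - 0\<bar>"
  proof -
    have "0 \<in> {0..n2}" using Ns by (simp add: n2_def)
    then show ?thesis using f1_increment[of 0 n2] that by blast
  qed
  define c where "c = D + p2 * L"
  have p2: "0 < p2" "Ps \<le> p2" using Ps by (auto simp: p2_def)
  have c: "0 < c" using D p2 L by (simp add: c_def add_pos_pos)
  have \<mu>pos: "0 < \<mu>" using \<mu> Ns by (simp add: Ns_def)
  define n1 where "n1 = min Ns (min (\<mu> * D / c) (N 0))"
  have n1: "0 < n1" "n1 \<le> Ns" using Ns c \<mu>pos D Npos[of 0] by (auto simp: n1_def)
  have n2: "Ns \<le> n2" by (simp add: n2_def)
  have Nge: "n1 \<le> N T" if T: "0 \<le> T" for T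
  proof -
    let ?y = "\<lambda>t. \<mu> * D / c - N t"
    have "?y T \<le> ?y 0 * exp (- c * T)"
    proof (rule exponential_decay[OF T])
      fix t assume t: "t \<in> {0..T}"
      show "(?y has_real_derivative 0 - ((\<mu> - N t) * D - P t * f1 (N t))) (at t within {0..T})"
        by (intro DERIV_diff DERIV_const Nd[OF t])
      have "N t \<in> {0..n2}" using Npos[of t] Nle[of t] t by (simp add: less_imp_le)
      then have "\<bar>f1 (N t) - f1 0\<bar> \<le> L * \<bar>N t - 0\<bar>" using L(2) by blast
      then have "f1 (N t) \<le> L * N t" using f1_0 Npos[of t] t by simp
      then have "P t * f1 (N t) \<le> p2 * (L * N t)"
        using Ppos[of t] Ple[of t] p2 t f1_pos[of "N t"] Npos[of t] by (intro mult_mono) auto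
      moreover have "- c * ?y t = - (\<mu> * D) + c * N t"
        using c by (simp add: right_diff_distrib)
      moreover have "c * N t = D * N t + p2 * (L * N t)"
        by (simp add: c_def algebra_simps)
      ultimately show "0 - ((\<mu> - N t) * D - P t * f1 (N t)) \<le> - c * ?y t"
        by (simp add: left_diff_distrib mult.commute[of D])
    qed
    also have "\<dots> \<le> max 0 (?y 0) * exp (- c * T)" by (intro mult_right_mono) auto
    also have "\<dots> \<le> max 0 (?y 0) * 1" using c T by (intro mult_left_mono) auto
    finally show ?thesis by (simp add: n1_def min_def max_def split: if_splits)
  qed
  obtain \<phi> k0 where \<phi>: "0 < k0"
    "\<forall>n\<in>{n1..n2}. (\<phi> has_real_derivative 1 - f1 Ns / f1 n) (at n within {n1..n2}) \<and> k0 * (n - Ns)\<^sup>2 \<le> \<phi> n"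
    using N_potential[OF n1 n2] by blast
  define V where "V t = \<phi> (N t) + P_pot (P t) / \<gamma>1" for t
  have Vle: "V T \<le> V 0" if T: "0 \<le> T" for T
  proof (rule antitone_of_deriv_nonpos_within[OF T])
    fix t assume t: "t \<in> {0..T}"
    have "N ` {0..T} \<subseteq> {n1..n2}" using Nge Nle by auto
    moreover have "(\<phi> has_real_derivative 1 - f1 Ns / f1 (N t)) (at (N t) within {n1..n2})"
      using \<phi>(2) Nge Nle t by auto
    ultimately have 1: "((\<lambda>s. \<phi> (N s)) has_real_derivative
        (1 - f1 Ns / f1 (N t)) * ((\<mu> - N t) * D - P t * f1 (N t))) (at t within {0..T})"
      using DERIV_image_chain[OF DERIV_subset Nd[OF t]] by (fastforce simp: o_def)
    have "0 < P t" using Ppos t by simp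
    then have 2: "((\<lambda>s. P_pot (P s)) has_real_derivative
        (1 - Ps / P t) * (\<gamma>1 * P t * f1 (N t) - D1 * P t)) (at t within {0..T})"
      using DERIV_image_chain[OF P_pot_deriv Pd[OF t]] by (simp add: o_def)
    show "(V has_real_derivative (1 - f1 Ns / f1 (N t)) * ((\<mu> - N t) * D - P t * f1 (N t))
        + (1 - Ps / P t) * (\<gamma>1 * P t * f1 (N t) - D1 * P t) / \<gamma>1) (at t within {0..T})"
      unfolding V_def[abs_def] by (intro DERIV_add DERIV_cdivide 1 2)
    show "(1 - f1 Ns / f1 (N t)) * ((\<mu> - N t) * D - P t * f1 (N t))
        + (1 - Ps / P t) * (\<gamma>1 * P t * f1 (N t) - D1 * P t) / \<gamma>1 \<le> 0"
      using planar_potential_decreases[of "N t" "P t"] Npos[of t] Ppos[of t] t by simp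
  qed
  define p1 where "p1 = Ps * exp (- ((max 0 (\<gamma>1 * V 0) + Ps) / Ps))"
  have p1: "0 < p1" "p1 \<le> Ps" using Ps by (auto simp: p1_def)
  have Pge: "p1 \<le> P t" if "0 \<le> t" for t
  proof -
    have "k0 * (N t - Ns)\<^sup>2 \<le> \<phi> (N t)" using \<phi>(2) Nge[OF that] Nle[OF that] by simp
    then have "0 \<le> \<phi> (N t)" using \<phi>(1) by (meson less_imp_le mult_nonneg_nonneg order_trans zero_le_power2)
    then have "P_pot (P t) / \<gamma>1 \<le> V 0" using Vle[OF that] by (simp add: V_def)
    then have "P_pot (P t) \<le> \<gamma>1 * V 0" using \<gamma>1 by (simp add: field_simps)
    then show ?thesis unfolding p1_def by (intro P_pot_sublevel Ppos[OF that]) auto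
  qed
  obtain W WN WP k C \<alpha> where kC: "0 < k" "0 < C" "0 < \<alpha>" and
    W: "\<forall>x\<in>{n1..n2}. \<forall>y\<in>{p1..p2}.
      k * ((x - Ns)\<^sup>2 + (y - Ps)\<^sup>2) \<le> W x y \<and> W x y \<le> C * ((x - Ns)\<^sup>2 + (y - Ps)\<^sup>2) \<and>
      WN x y * ((\<mu> - x) * D - y * f1 x) + WP x y * (\<gamma>1 * y * f1 x - D1 * y)
        \<le> - \<alpha> * ((x - Ns)\<^sup>2 + (y - Ps)\<^sup>2) \<and>
      \<bar>WP x y\<bar> \<le> C" and
    der: "\<forall>N P N' P' t S. t \<in> S \<longrightarrow> N ` S \<subseteq> {n1..n2} \<longrightarrow> P ` S \<subseteq> {p1..p2} \<longrightarrow>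
      (N has_real_derivative N') (at t within S) \<longrightarrow> (P has_real_derivative P') (at t within S) \<longrightarrow>
      ((\<lambda>s. W (N s) (P s)) has_real_derivative WN (N t) (P t) * N' + WP (N t) (P t) * P') (at t within S)"
    using planar_lyapunov[OF n1 n2 p1 p2(2)] by (elim exE conjE)
  have decay: "W (N T) (P T) \<le> W (N 0) (P 0) * exp (- (\<alpha> / C) * T)" if T: "0 \<le> T" for T
  proof (rule exponential_decay[OF T])
    fix t assume t: "t \<in> {0..T}"
    have "N ` {0..T} \<subseteq> {n1..n2}" "P ` {0..T} \<subseteq> {p1..p2}" using Nge Nle Pge Ple by auto
    then show "((\<lambda>t. W (N t) (P t)) has_real_derivative
        WN (N t) (P t) * ((\<mu> - N t) * D - P t * f1 (N t))
        + WP (N t) (P t) * (\<gamma>1 * P t * f1 (N t) - D1 * P t)) (at t within {0..T})"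
      using der[rule_format, OF t _ _ Nd[OF t] Pd[OF t]] by blast
    let ?q = "(N t - Ns)\<^sup>2 + (P t - Ps)\<^sup>2"
    have W': "W (N t) (P t) \<le> C * ?q"
      "WN (N t) (P t) * ((\<mu> - N t) * D - P t * f1 (N t))
        + WP (N t) (P t) * (\<gamma>1 * P t * f1 (N t) - D1 * P t) \<le> - \<alpha> * ?q"
      using W Nge[of t] Nle[of t] Pge[of t] Ple[of t] t by auto
    have "\<alpha> / C * W (N t) (P t) \<le> \<alpha> / C * (C * ?q)"
      using W'(1) kC by (intro mult_left_mono) auto
    also have "\<dots> = \<alpha> * ?q" using kC by simp
    finally show "WN (N t) (P t) * ((\<mu> - N t) * D - P t * f1 (N t))
        + WP (N t) (P t) * (\<gamma>1 * P t * f1 (N t) - D1 * P t) \<le> - (\<alpha> / C) * W (N t) (P t)"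
      using W'(2) by simp
  qed
  show ?thesis
  proof (rule tendsto_of_exp_dist_bound)
    show "0 < \<alpha> / C" using kC by simp
    fix t :: real assume t: "0 \<le> t"
    have "k * (dist (x t) E1)\<^sup>2 = k * ((N t - Ns)\<^sup>2 + (P t - Ps)\<^sup>2)"
      using Z0[OF t] by (simp add: dist_E1 N_def P_def)
    also have "\<dots> \<le> W (N t) (P t)"
      using W Nge[OF t] Nle[OF t] Pge[OF t] Ple[OF t] by simp
    also have "\<dots> \<le> W (N 0) (P 0) * exp (- (\<alpha> / C) * t)" by (rule decay[OF t])
    finally show "(dist (x t) E1)\<^sup>2 \<le> W (N 0) (P 0) / k * exp (- (\<alpha> / C) * t)"
      using kC by (simp add: field_simps)
  qed
qed

end

section \<open>Eigenvalues of the Jacobian\<close>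

lemma has_derivative_vec_componentwise:
  fixes G :: "'a::real_normed_vector \<Rightarrow> real^'n"
  assumes "\<And>i. ((\<lambda>x. G x $ i) has_derivative (\<lambda>h. G' h $ i)) (at a)"
  shows "(G has_derivative G') (at a)"
  unfolding has_derivative_componentwise_within[of G]
proof
  fix b :: "real^'n" assume "b \<in> Basis"
  then obtain i where "b = axis i 1" by (auto simp: Basis_vec_def)
  then show "((\<lambda>x. G x \<bullet> b) has_derivative (\<lambda>h. G' h \<bullet> b)) (at a)"
    using assms[of i] by (simp add: inner_axis)
qed

lemma positive_eigenvalues_block:
  fixes s p q g a :: real
  assumes "0 < s" "0 < p" "0 < q" "0 < a"
  defines "A \<equiv> vector [vector [- s, - p, 0], vector [q, 0, - g], vector [0, 0, a]] :: real^3^3"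
  shows "{z. is_eigenvalue A z \<and> Re z > 0} = {complex_of_real a}"
proof -
  have eig: "is_eigenvalue A z \<longleftrightarrow> (\<exists>v::complex^3. (v$1 \<noteq> 0 \<or> v$2 \<noteq> 0 \<or> v$3 \<noteq> 0) \<and>
      - complex_of_real s * v$1 - complex_of_real p * v$2 = z * v$1 \<and>
      complex_of_real q * v$1 - complex_of_real g * v$3 = z * v$2 \<and>
      complex_of_real a * v$3 = z * v$3)" for z
    unfolding is_eigenvalue_def A_def
    by (simp add: vec_eq_iff forall_3 matrix_vector_mult_def sum_3)
  have only: "z = a" if ev: "is_eigenvalue A z" and z: "Re z > 0" for z :: complex
  proof (rule ccontr)
    assume "z \<noteq> a"
    obtain v :: "complex^3" where v': "(v$1 \<noteq> 0 \<or> v$2 \<noteq> 0 \<or> v$3 \<noteq> 0) \<and>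
      - complex_of_real s * v$1 - complex_of_real p * v$2 = z * v$1 \<and>
      complex_of_real q * v$1 - complex_of_real g * v$3 = z * v$2 \<and>
      complex_of_real a * v$3 = z * v$3"
      using ev unfolding eig by (elim exE)
    define v1 v2 v3 where "v1 = v$1" and "v2 = v$2" and "v3 = v$3"
    have v: "v1 \<noteq> 0 \<or> v2 \<noteq> 0 \<or> v3 \<noteq> 0" "- complex_of_real s * v1 - complex_of_real p * v2 = z * v1"
      "complex_of_real q * v1 - complex_of_real g * v3 = z * v2" "complex_of_real a * v3 = z * v3"
      using v' by (auto simp: v1_def v2_def v3_def)
    have z0: "z \<noteq> 0" using z by auto
    have v3: "v3 = 0" using v(4) \<open>z \<noteq> a\<close> by auto
    have v2: "z * v2 = q * v1" using v(3) v3 by simp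
    have "v1 \<noteq> 0" using v(1) v2 v3 z0 by auto
    have "(z * z + s * z + p * q) * v1 = 0"
      using v(2) v2 unfolding of_real_mult by algebra
    then have root: "z * z + s * z + p * q = 0" using \<open>v1 \<noteq> 0\<close> by simp
    \<comment> \<open>Multiplying by \<open>cnj z\<close> makes the real part a sum of positive terms.\<close>
    have "Re (cnj z * (z * z + s * z + p * q)) = 0" unfolding root by simp
    moreover have "Re (cnj z * (z * z + s * z + p * q)) = (Re z * (Re z)\<^sup>2 + Re z * (Im z)\<^sup>2)
        + s * ((Re z)\<^sup>2 + (Im z)\<^sup>2) + p * q * Re z"
      by (simp add: power2_eq_square algebra_simps)
    moreover have "0 < \<dots>"
      using assms(1-3) z by (intro add_nonneg_pos add_nonneg_nonneg mult_nonneg_nonneg mult_pos_pos) auto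
    ultimately show False by simp
  qed
  have ev_a: "is_eigenvalue A a"
  proof -
    define c where "c = a * a + s * a + p * q"
    have c: "0 < c" using assms(1-4) by (simp add: c_def add_pos_pos)
    have e1: "- s * (g * p) - p * (- g * (a + s)) = a * (g * p)" by (simp add: algebra_simps)
    have e3: "q * (g * p) - g * c = a * (- g * (a + s))"
      by (simp add: c_def algebra_simps)
    show ?thesis
      unfolding eig
    proof (intro exI[of _ "vector [complex_of_real (g * p), complex_of_real (- g * (a + s)), complex_of_real c]"],
        unfold vector_3, intro conjI)
      show "complex_of_real (g * p) \<noteq> 0 \<or> complex_of_real (- g * (a + s)) \<noteq> 0 \<or> complex_of_real c \<noteq> 0"
        using c by simp
      show "- complex_of_real s * complex_of_real (g * p) - complex_of_real p * complex_of_real (- g * (a + s))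
          = complex_of_real a * complex_of_real (g * p)"
        unfolding of_real_mult[symmetric] of_real_minus[symmetric] of_real_diff[symmetric] e1 ..
      show "complex_of_real q * complex_of_real (g * p) - complex_of_real g * complex_of_real c
          = complex_of_real a * complex_of_real (- g * (a + s))"
        unfolding of_real_mult[symmetric] of_real_diff[symmetric] e3 ..
    qed simp
  qed
  show ?thesis
  proof (intro equalityI subsetI)
    fix z assume "z \<in> {z. is_eigenvalue A z \<and> Re z > 0}"
    then show "z \<in> {complex_of_real a}" using only by blast
  next
    fix z assume "z \<in> {complex_of_real a}"
    then show "z \<in> {z. is_eigenvalue A z \<and> Re z > 0}" using ev_a assms(4) by simp
  qed
qed

context npz_system
begin

lemma jacobian_E1:
  "jacobian F E1 = vector [vector [- (D + Ps * f1' Ns), - f1 Ns, 0],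
     vector [\<gamma>1 * Ps * f1' Ns, 0, - f2 Ps], vector [0, 0, \<gamma>2 * f2 Ps - D2]]" (is "_ = ?A")
proof -
  have d1: "(f1 has_real_derivative f1' Ns) (at Ns)"
    using f1_der[of Ns] Ns at_within_interior[of Ns "{0..}"] by simp
  have d2: "(f2 has_real_derivative f2' Ps) (at Ps)"
    using f2_der[of Ps] Ps at_within_interior[of Ps "{0..}"] by simp
  have c: "((\<lambda>x::real^3. x $ i) has_derivative (\<lambda>h. h $ i)) (at E1)" for i
    by (rule bounded_linear_imp_has_derivative[OF bounded_linear_vec_nth])
  have g1: "((\<lambda>x::real^3. f1 (x $ 1)) has_derivative (\<lambda>h. f1' Ns * h $ 1)) (at E1)"
    using has_derivative_compose[OF c[of 1], of f1 "\<lambda>h. f1' Ns * h"] d1 by (simp add: has_field_derivative_def)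
  have g2: "((\<lambda>x::real^3. f2 (x $ 2)) has_derivative (\<lambda>h. f2' Ps * h $ 2)) (at E1)"
    using has_derivative_compose[OF c[of 2], of f2 "\<lambda>h. f2' Ps * h"] d2 by (simp add: has_field_derivative_def)
  have m1: "((\<lambda>x::real^3. x $ 2 * f1 (x $ 1)) has_derivative (\<lambda>h. Ps * (f1' Ns * h $ 1) + h $ 2 * f1 Ns)) (at E1)"
    using has_derivative_mult[OF c[of 2] g1] by simp
  have m2: "((\<lambda>x::real^3. x $ 3 * f2 (x $ 2)) has_derivative (\<lambda>h. h $ 3 * f2 Ps)) (at E1)"
    using has_derivative_mult[OF c[of 3] g2] by simp
  have fNs: "\<gamma>1 * f1 Ns = D1" using \<gamma>1 by (simp add: Ns(2))
  have "(F has_derivative (\<lambda>h. ?A *v h)) (at E1)"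
  proof (rule has_derivative_vec_componentwise)
    fix i :: 3
    have 1: "((\<lambda>x. F x $ 1) has_derivative (\<lambda>h. (?A *v h) $ 1)) (at E1)"
      unfolding F_nth
      by (rule has_derivative_eq_rhs[OF has_derivative_diff[OF
            has_derivative_mult_left[OF has_derivative_diff[OF has_derivative_const c]] m1]])
        (simp add: fun_eq_iff matrix_vector_mult_def sum_3 algebra_simps)
    have "((\<lambda>x. \<gamma>1 * (x $ 2 * f1 (x $ 1)) - D1 * x $ 2 - x $ 3 * f2 (x $ 2)) has_derivative
        (\<lambda>h. \<gamma>1 * (Ps * (f1' Ns * h $ 1) + h $ 2 * f1 Ns) - D1 * h $ 2 - h $ 3 * f2 Ps)) (at E1)"
      by (intro has_derivative_diff has_derivative_mult_right m1 m2 c)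
    moreover have "\<gamma>1 * (Ps * (f1' Ns * h $ 1) + h $ 2 * f1 Ns) - D1 * h $ 2 - h $ 3 * f2 Ps = (?A *v h) $ 2" for h
    proof -
      have "\<gamma>1 * (h $ 2 * f1 Ns) = (\<gamma>1 * f1 Ns) * h $ 2" by simp
      also have "\<dots> = D1 * h $ 2" by (simp only: fNs)
      finally have "\<gamma>1 * (h $ 2 * f1 Ns) = D1 * h $ 2" .
      then show ?thesis by (simp add: matrix_vector_mult_def sum_3 distrib_left)
    qed
    ultimately have 2: "((\<lambda>x. F x $ 2) has_derivative (\<lambda>h. (?A *v h) $ 2)) (at E1)"
      by (simp add: F_nth mult.assoc)
    have "((\<lambda>x. \<gamma>2 * (x $ 3 * f2 (x $ 2)) - D2 * x $ 3) has_derivative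
        (\<lambda>h. \<gamma>2 * (h $ 3 * f2 Ps) - D2 * h $ 3)) (at E1)"
      by (intro has_derivative_diff has_derivative_mult_right m2 c)
    moreover have "\<gamma>2 * (h $ 3 * f2 Ps) - D2 * h $ 3 = (?A *v h) $ 3" for h
      by (simp add: matrix_vector_mult_def sum_3 algebra_simps)
    ultimately have 3: "((\<lambda>x. F x $ 3) has_derivative (\<lambda>h. (?A *v h) $ 3)) (at E1)"
      by (simp add: F_nth mult.assoc)
    show "((\<lambda>x. F x $ i) has_derivative (\<lambda>h. (?A *v h) $ i)) (at E1)"
      using 1 2 3 exhaust_3[of i] by auto
  qed
  then show ?thesis
    unfolding jacobian_def by (simp add: frechet_derivative_at[symmetric])
qed

lemma E1_positive_eigenvalues:
  assumes "D2 < \<gamma>2 * f2 Ps"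
  shows "card {z. is_eigenvalue (jacobian F E1) z \<and> Re z > 0} = 1"
proof -
  have "{z. is_eigenvalue (jacobian F E1) z \<and> Re z > 0} = {complex_of_real (\<gamma>2 * f2 Ps - D2)}"
    unfolding jacobian_E1
  proof (rule positive_eigenvalues_block)
    have "0 < f1' Ns" using f1'_pos[of Ns] Ns(1) by simp
    then show "0 < D + Ps * f1' Ns" "0 < \<gamma>1 * Ps * f1' Ns"
      using D \<gamma>1 Ps by (simp_all add: add_pos_pos)
    show "0 < f1 Ns" using f1_pos Ns(1) by blast
    show "0 < \<gamma>2 * f2 Ps - D2" using assms by simp
  qed
  then show ?thesis by simp
qed


lemma lamZ: "0 < lam f2 \<gamma>2 D2" "f2 (lam f2 \<gamma>2 D2) = D2 / \<gamma>2"
  using lam_solution[OF f2_der f2'_pos f2_0 f2_lim D2 \<gamma>2] by auto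

lemma mu_c1_less_iff:
  "\<mu> < mu_c1 D \<gamma>1 \<gamma>2 f1 f2 D1 D2 \<longleftrightarrow> Ps < lam f2 \<gamma>2 D2"
  "mu_c1 D \<gamma>1 \<gamma>2 f1 f2 D1 D2 < \<mu> \<longleftrightarrow> lam f2 \<gamma>2 D2 < Ps"
  using D D1 \<gamma>1 by (simp_all add: mu_c1_def Ps_def Ns_def[symmetric] field_simps)

lemma stable_below_mu_c1:
  assumes "\<mu> < mu_c1 D \<gamma>1 \<gamma>2 f1 f2 D1 D2"
  shows "loc_asymp_stable_in orthant F E1"
proof (rule E1_loc_asymp_stable)
  let ?p2 = "(Ps + lam f2 \<gamma>2 D2) / 2"
  have p2: "Ps < ?p2" "?p2 < lam f2 \<gamma>2 D2"
    using assms by (simp_all add: mu_c1_less_iff)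
  show "Ps < ?p2" by (fact p2)
  have "f2 ?p2 < D2 / \<gamma>2"
    using f2_strict_mono[OF _ p2(2)] Ps lamZ by simp
  then show "\<gamma>2 * f2 ?p2 < D2" using \<gamma>2 by (simp add: field_simps)
qed

lemma unstable_above_mu_c1:
  assumes "mu_c1 D \<gamma>1 \<gamma>2 f1 f2 D1 D2 < \<mu>"
  shows "\<not> lyap_stable_in orthant F E1"
    and "card {z. is_eigenvalue (jacobian F E1) z \<and> Re z > 0} = 1"
proof -
  have grow: "D2 < \<gamma>2 * f2 p" if "lam f2 \<gamma>2 D2 < p" for p
  proof -
    have "D2 / \<gamma>2 < f2 p" using f2_strict_mono[OF _ that] lamZ by simp
    then show ?thesis using \<gamma>2 by (simp add: field_simps)
  qed
  have less: "lam f2 \<gamma>2 D2 < Ps" using assms by (simp add: mu_c1_less_iff)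
  show "card {z. is_eigenvalue (jacobian F E1) z \<and> Re z > 0} = 1"
    by (rule E1_positive_eigenvalues[OF grow[OF less]])
  let ?p1 = "(lam f2 \<gamma>2 D2 + Ps) / 2"
  have "0 \<le> ?p1" "?p1 < Ps" "lam f2 \<gamma>2 D2 < ?p1"
    using less lamZ(1) Ps by simp_all
  then show "\<not> lyap_stable_in orthant F E1"
    by (intro E1_not_lyap_stable[of ?p1] grow)
qed

end

theorem theorem2p4:
  fixes D D1 D2 \<gamma>1 \<gamma>2 \<mu> :: real and f1 f2 :: "real \<Rightarrow> real"
  assumes pos: "D > 0" "D1 > 0" "D2 > 0" "\<gamma>1 > 0" "\<gamma>2 > 0" "\<mu> > 0"
    and f1_diff: "\<exists>f1'. continuous_on {0..} f1' \<and>
        (\<forall>x\<ge>0. (f1 has_real_derivative f1' x) (at x within {0..}) \<and> f1' x > 0)"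
    and f2_diff: "\<exists>f2'. continuous_on {0..} f2' \<and>
        (\<forall>x\<ge>0. (f2 has_real_derivative f2' x) (at x within {0..}) \<and> f2' x > 0)"
    and f1_nonneg: "\<forall>x\<ge>0. f1 x \<ge> 0" and f2_nonneg: "\<forall>x\<ge>0. f2 x \<ge> 0"
    and f1_bdd: "bounded (f1 ` {0..})" and f2_bdd: "bounded (f2 ` {0..})"
    and f1_0: "f1 0 = 0" and f2_0: "f2 0 = 0"
    and f1_lim: "\<exists>L. (f1 \<longlongrightarrow> L) at_top \<and> L > max D D1 / \<gamma>1"
    and f2_lim: "\<exists>L. (f2 \<longlongrightarrow> L) at_top \<and> L > max D D2 / \<gamma>2"
  defines "F \<equiv> npz_field \<mu> D D1 D2 \<gamma>1 \<gamma>2 f1 f2"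
    and "E1 \<equiv> npz (lam f1 \<gamma>1 D1) ((\<mu> - lam f1 \<gamma>1 D1) * D * \<gamma>1 / D1) 0"
    and "\<mu>c1 \<equiv> mu_c1 D \<gamma>1 \<gamma>2 f1 f2 D1 D2"
  shows "(lam f1 \<gamma>1 D1 < \<mu> \<and> \<mu> < \<mu>c1 \<longrightarrow> loc_asymp_stable_in orthant F E1)
       \<and> (\<mu> > \<mu>c1 \<longrightarrow>
            \<not> lyap_stable_in orthant F E1
          \<and> card {z. is_eigenvalue (jacobian F E1) z \<and> Re z > 0} = 1
          \<and> (\<forall>x. ode_solution F x \<and> x 0 $ 1 > 0 \<and> x 0 $ 2 > 0 \<and> x 0 $ 3 = 0
                  \<longrightarrow> (x \<longlongrightarrow> E1) at_top))"
proof -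
  obtain f1' where f1': "continuous_on {0..} f1'"
    "\<And>x. 0 \<le> x \<Longrightarrow> (f1 has_real_derivative f1' x) (at x within {0..})" "\<And>x. 0 \<le> x \<Longrightarrow> f1' x > 0"
    using f1_diff by blast
  obtain f2' where f2': "continuous_on {0..} f2'"
    "\<And>x. 0 \<le> x \<Longrightarrow> (f2 has_real_derivative f2' x) (at x within {0..})" "\<And>x. 0 \<le> x \<Longrightarrow> f2' x > 0"
    using f2_diff by blast
  obtain L1 L2 where L: "(f1 \<longlongrightarrow> L1) at_top" "L1 > max D D1 / \<gamma>1"
      "(f2 \<longlongrightarrow> L2) at_top" "L2 > max D D2 / \<gamma>2"
    using f1_lim f2_lim by blast
  have "D1 / \<gamma>1 \<le> max D D1 / \<gamma>1" "D2 / \<gamma>2 \<le> max D D2 / \<gamma>2"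
    using pos by (auto intro!: divide_right_mono)
  then have L': "D1 / \<gamma>1 < L1" "D2 / \<gamma>2 < L2" using L by auto
  have sys: "npz_system D D1 D2 \<gamma>1 \<gamma>2 \<mu> f1 f2 f1' f2' L1 L2" if "lam f1 \<gamma>1 D1 < \<mu>"
    by unfold_locales (fact pos f1' f2' f1_0 f2_0 L L' that)+
  have stable: "loc_asymp_stable_in orthant F E1" if "lam f1 \<gamma>1 D1 < \<mu>" "\<mu> < \<mu>c1"
  proof -
    interpret S: npz_system D D1 D2 \<gamma>1 \<gamma>2 \<mu> f1 f2 f1' f2' L1 L2 by (rule sys[OF that(1)])
    show ?thesis
      using S.stable_below_mu_c1 that(2)
      by (simp add: \<mu>c1_def F_def E1_def S.F_def S.E1_def S.Ps_def S.Ns_def)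
  qed
  have unstable: "\<not> lyap_stable_in orthant F E1 \<and>
      card {z. is_eigenvalue (jacobian F E1) z \<and> Re z > 0} = 1 \<and>
      (\<forall>x. ode_solution F x \<and> x 0 $ 1 > 0 \<and> x 0 $ 2 > 0 \<and> x 0 $ 3 = 0 \<longrightarrow> (x \<longlongrightarrow> E1) at_top)"
    if "\<mu>c1 < \<mu>"
  proof -
    have "0 < lam f2 \<gamma>2 D2"
      by (rule lam_solution(1)[OF f2'(2,3) f2_0 L(3) L'(2) pos(3,5)])
    then have "lam f1 \<gamma>1 D1 < \<mu>c1" using pos by (simp add: \<mu>c1_def mu_c1_def)
    then interpret S: npz_system D D1 D2 \<gamma>1 \<gamma>2 \<mu> f1 f2 f1' f2' L1 L2
      using that by (intro sys) simp
    have F: "S.F = F" and E1: "S.E1 = E1"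
      by (simp_all add: F_def E1_def S.F_def S.E1_def S.Ps_def S.Ns_def)
    have "mu_c1 D \<gamma>1 \<gamma>2 f1 f2 D1 D2 < \<mu>" using that by (simp add: \<mu>c1_def)
    then show ?thesis
      using S.unstable_above_mu_c1 S.boundary_face_convergence unfolding F E1 by blast
  qed
  show ?thesis using stable unstable by blast
qed

end
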